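(* Let $T$ be a consistent RE theory and $n\geq1$. Suppose $T$ is $n$-Rosser via an interpretation $I:{\sf Num}\unlhd T$, and every recursive $n$-ary functional on $\mathbb N^n$ is strongly definable in $T$ with respect to $I$. Then $T$ is exact $n$-Rosser.
   Context: A fixed Gödel numbering of formulas is used. ${\sf Num}$ is the theory in the language $\{\mathbf 0,\mathbf S\}$ with axioms $\overline m\neq\overline n$ for $m\neq n$, where $\overline 0=\mathbf 0$, $\overline{k+1}=\mathbf S\overline k$. An interpretation $I:{\sf Num}\unlhd T$ is a translation of the language of ${\sf Num}$ into that of $T$ (domain formula $\delta_I$ and translations of $=,\mathbf 0,\mathbf S$) such that $T$ proves totality of translated function symbols on $\delta_I$, the translations of all theorems of ${\sf Num}$ and of the equality axioms; $\overline a^I$ is the $I$-translation of $\overline a$. For $n$-ary relations $M_1,M_2$, a formula $\phi(x_1,\dots,x_n)$ with exactly $n$ free variables strongly separates $M_1$ from $M_2$ in $T$ w.r.t. $I$ if $\vec a\in M_1\Rightarrow T\vdash\phi(\overline{a_1}^I,\dots,\overline{a_n}^I)$ and $\vec a\in M_2\Rightarrow T\vdash\neg\phi(\overline{a_1}^I,\dots,\overline{a_n}^I)$; for disjoint $M_1,M_2$ it exactly separates them if both are equivalences. $T$ is $n$-Rosser via $I$ if for every pair of $n$-ary RE relations $M_1,M_2$ some formula strongly separates $M_1\setminus M_2$ from $M_2\setminus M_1$ w.r.t. $I$; $T$ is exact $n$-Rosser if for some interpretation $I':{\sf Num}\unlhd T$ every disjoint pair of $n$-ary RE relations is exactly separated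 by some formula w.r.t. $I'$. An $n$-ary functional on $\mathbb N^n$ is a map $F=(f_1,\dots,f_n):\mathbb N^n\to\mathbb N^n$, recursive if each $f_i$ is. $F$ is strongly definable in $T$ w.r.t. $I$ if for each $1\le i\le n$ there is a formula $\varphi_i(x_1,\dots,x_n,y)$ such that for all $\vec a\in\mathbb N^n$, $T\vdash\forall y[\varphi_i(\overline{a_1}^I,\dots,\overline{a_n}^I,y)\leftrightarrow y=\overline{f_i(\vec a)}^I]$. *)

theory Defs
  imports Main "HOL-Library.Nat_Bijection"
begin

section \<open>Recursive functions and recursively enumerable relations\<close>

datatype recf =
    Zero
  | Succ
  | Proj nat
  | Comp recf "recf list"
  | PrimRec recf recf
  | Mu recf

text \<open>\<open>rec_eval f xs y\<close>: the partial recursive function described by \<open>f\<close> is defined at the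
  argument tuple \<open>xs\<close> and has the value \<open>y\<close> there.  In \<open>PrimRec\<close> and \<open>Mu\<close> the recursion
  (search) variable is the first argument.\<close>

inductive rec_eval :: "recf \<Rightarrow> nat list \<Rightarrow> nat \<Rightarrow> bool" where
  Zero: "rec_eval Zero xs 0"
| Succ: "rec_eval Succ [x] (Suc x)"
| Proj: "i < length xs \<Longrightarrow> rec_eval (Proj i) xs (xs ! i)"
| Comp: "list_all2 (\<lambda>h y. rec_eval h xs y) hs ys \<Longrightarrow> rec_eval g ys z
    \<Longrightarrow> rec_eval (Comp g hs) xs z"
| PrimRec_0: "rec_eval f xs y \<Longrightarrow> rec_eval (PrimRec f g) (0 # xs) y"
| PrimRec_Suc: "rec_eval (PrimRec f g) (k # xs) y \<Longrightarrow> rec_eval g (k # y # xs) z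
    \<Longrightarrow> rec_eval (PrimRec f g) (Suc k # xs) z"
| Mu: "rec_eval f (k # xs) 0 \<Longrightarrow> (\<forall>m<k. \<exists>y. rec_eval f (m # xs) (Suc y))
    \<Longrightarrow> rec_eval (Mu f) xs k"

text \<open>\<open>n\<close>-ary relations on the natural numbers are sets of lists of length \<open>n\<close>.\<close>

definition tuples :: "nat \<Rightarrow> nat list set" where
  "tuples n = {xs. length xs = n}"

definition recursive_fun :: "nat \<Rightarrow> (nat list \<Rightarrow> nat) \<Rightarrow> bool" where
  "recursive_fun n g \<longleftrightarrow> (\<exists>f. \<forall>xs\<in>tuples n. \<forall>y. rec_eval f xs y \<longleftrightarrow> y = g xs)"

definition recursive_rel :: "nat \<Rightarrow> nat list set \<Rightarrow> bool" where
  "recursive_rel n M \<longleftrightarrow> M \<subseteq> tuples n \<and> recursive_fun n (\<lambda>xs. if xs \<in> M then 1 else 0)"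

definition RE_rel :: "nat \<Rightarrow> nat list set \<Rightarrow> bool" where
  "RE_rel n M \<longleftrightarrow> M \<subseteq> tuples n \<and>
     (\<exists>f. \<forall>xs\<in>tuples n. xs \<in> M \<longleftrightarrow> (\<exists>y. rec_eval f xs y))"

definition recursive_functional :: "nat \<Rightarrow> (nat list \<Rightarrow> nat list) \<Rightarrow> bool" where
  "recursive_functional n F \<longleftrightarrow>
     (\<forall>as\<in>tuples n. F as \<in> tuples n) \<and> (\<forall>i<n. recursive_fun n (\<lambda>as. F as ! i))"


section \<open>First-order logic with equality\<close>

text \<open>Variables are de Bruijn indices: in \<open>All \<phi>\<close> the quantifier binds index 0 of \<open>\<phi>\<close>.
  A function or relation symbol is a pair of a name and an arity.\<close>

datatype tm = Var nat | Fn nat "tm list"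

datatype fm = Eq tm tm | Rel nat "tm list" | Falsum | Imp fm fm | All fm

abbreviation Neg :: "fm \<Rightarrow> fm" where "Neg \<phi> \<equiv> Imp \<phi> Falsum"
abbreviation Conj :: "fm \<Rightarrow> fm \<Rightarrow> fm" where "Conj \<phi> \<psi> \<equiv> Neg (Imp \<phi> (Neg \<psi>))"
abbreviation Iff :: "fm \<Rightarrow> fm \<Rightarrow> fm" where "Iff \<phi> \<psi> \<equiv> Conj (Imp \<phi> \<psi>) (Imp \<psi> \<phi>)"
abbreviation Ex :: "fm \<Rightarrow> fm" where "Ex \<phi> \<equiv> Neg (All (Neg \<phi>))"
abbreviation Conj_list :: "fm list \<Rightarrow> fm" where "Conj_list \<phi>s \<equiv> foldr Conj \<phi>s (Neg Falsum)"

record lang =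
  funs :: "(nat \<times> nat) set"
  rels :: "(nat \<times> nat) set"

fun wf_tm :: "lang \<Rightarrow> tm \<Rightarrow> bool" where
  "wf_tm L (Var x) \<longleftrightarrow> True"
| "wf_tm L (Fn f ts) \<longleftrightarrow> (f, length ts) \<in> funs L \<and> (\<forall>t\<in>set ts. wf_tm L t)"

fun wf_fm :: "lang \<Rightarrow> fm \<Rightarrow> bool" where
  "wf_fm L (Eq s t) \<longleftrightarrow> wf_tm L s \<and> wf_tm L t"
| "wf_fm L (Rel r ts) \<longleftrightarrow> (r, length ts) \<in> rels L \<and> (\<forall>t\<in>set ts. wf_tm L t)"
| "wf_fm L Falsum \<longleftrightarrow> True"
| "wf_fm L (Imp \<phi> \<psi>) \<longleftrightarrow> wf_fm L \<phi> \<and> wf_fm L \<psi>"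
| "wf_fm L (All \<phi>) \<longleftrightarrow> wf_fm L \<phi>"

fun fv_tm :: "tm \<Rightarrow> nat set" where
  "fv_tm (Var x) = {x}"
| "fv_tm (Fn f ts) = (\<Union>t\<in>set ts. fv_tm t)"

fun fv_fm :: "fm \<Rightarrow> nat set" where
  "fv_fm (Eq s t) = fv_tm s \<union> fv_tm t"
| "fv_fm (Rel r ts) = (\<Union>t\<in>set ts. fv_tm t)"
| "fv_fm Falsum = {}"
| "fv_fm (Imp \<phi> \<psi>) = fv_fm \<phi> \<union> fv_fm \<psi>"
| "fv_fm (All \<phi>) = {x. Suc x \<in> fv_fm \<phi>}"

definition sentence :: "lang \<Rightarrow> fm \<Rightarrow> bool" where
  "sentence L \<phi> \<longleftrightarrow> wf_fm L \<phi> \<and> fv_fm \<phi> = {}"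

text \<open>Simultaneous capture-avoiding substitution.\<close>

fun subst_tm :: "(nat \<Rightarrow> tm) \<Rightarrow> tm \<Rightarrow> tm" where
  "subst_tm \<sigma> (Var x) = \<sigma> x"
| "subst_tm \<sigma> (Fn f ts) = Fn f (map (subst_tm \<sigma>) ts)"

definition lift_tm :: "tm \<Rightarrow> tm" where
  "lift_tm = subst_tm (\<lambda>x. Var (Suc x))"

fun subst_fm :: "(nat \<Rightarrow> tm) \<Rightarrow> fm \<Rightarrow> fm" where
  "subst_fm \<sigma> (Eq s t) = Eq (subst_tm \<sigma> s) (subst_tm \<sigma> t)"
| "subst_fm \<sigma> (Rel r ts) = Rel r (map (subst_tm \<sigma>) ts)"
| "subst_fm \<sigma> Falsum = Falsum"
| "subst_fm \<sigma> (Imp \<phi> \<psi>) = Imp (subst_fm \<sigma> \<phi>) (subst_fm \<sigma> \<psi>)"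
| "subst_fm \<sigma> (All \<phi>) = All (subst_fm (case_nat (Var 0) (\<lambda>x. lift_tm (\<sigma> x))) \<phi>)"

definition lift_fm :: "fm \<Rightarrow> fm" where
  "lift_fm = subst_fm (\<lambda>x. Var (Suc x))"

definition inst :: "fm \<Rightarrow> tm \<Rightarrow> fm" where
  "inst \<phi> t = subst_fm (case_nat t Var) \<phi>"

text \<open>Hilbert calculus; every formula of a derivation belongs to the language \<open>L\<close>.\<close>

inductive derives :: "lang \<Rightarrow> fm set \<Rightarrow> fm \<Rightarrow> bool" for L :: lang and T :: "fm set" where
  Axiom: "\<phi> \<in> T \<Longrightarrow> derives L T \<phi>"
| Ax_K: "wf_fm L \<phi> \<Longrightarrow> wf_fm L \<psi> \<Longrightarrow> derives L T (Imp \<phi> (Imp \<psi> \<phi>))"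
| Ax_S: "wf_fm L \<phi> \<Longrightarrow> wf_fm L \<psi> \<Longrightarrow> wf_fm L \<chi>
    \<Longrightarrow> derives L T (Imp (Imp \<phi> (Imp \<psi> \<chi>)) (Imp (Imp \<phi> \<psi>) (Imp \<phi> \<chi>)))"
| Ax_DN: "wf_fm L \<phi> \<Longrightarrow> derives L T (Imp (Neg (Neg \<phi>)) \<phi>)"
| Ax_inst: "wf_fm L \<phi> \<Longrightarrow> wf_tm L t \<Longrightarrow> derives L T (Imp (All \<phi>) (inst \<phi> t))"
| Ax_dist: "wf_fm L \<phi> \<Longrightarrow> wf_fm L \<psi>
    \<Longrightarrow> derives L T (Imp (All (Imp \<phi> \<psi>)) (Imp (All \<phi>) (All \<psi>)))"
| Ax_vac: "wf_fm L \<phi> \<Longrightarrow> derives L T (Imp \<phi> (All (lift_fm \<phi>)))"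
| Ax_refl: "wf_tm L t \<Longrightarrow> derives L T (Eq t t)"
| Ax_Leibniz: "wf_fm L \<phi> \<Longrightarrow> wf_tm L s \<Longrightarrow> wf_tm L t
    \<Longrightarrow> derives L T (Imp (Eq s t) (Imp (inst \<phi> s) (inst \<phi> t)))"
| MP: "derives L T (Imp \<phi> \<psi>) \<Longrightarrow> derives L T \<phi> \<Longrightarrow> derives L T \<psi>"
| Gen: "derives L T \<phi> \<Longrightarrow> derives L T (All \<phi>)"


section \<open>Theories\<close>

fun code_tm :: "tm \<Rightarrow> nat" where
  "code_tm (Var x) = prod_encode (0, x)"
| "code_tm (Fn f ts) = prod_encode (1, prod_encode (f, list_encode (map code_tm ts)))"

fun code_fm :: "fm \<Rightarrow> nat" where
  "code_fm (Eq s t) = prod_encode (0, prod_encode (code_tm s, code_tm t))"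
| "code_fm (Rel r ts) = prod_encode (1, prod_encode (r, list_encode (map code_tm ts)))"
| "code_fm Falsum = prod_encode (2, 0)"
| "code_fm (Imp \<phi> \<psi>) = prod_encode (3, prod_encode (code_fm \<phi>, code_fm \<psi>))"
| "code_fm (All \<phi>) = prod_encode (4, code_fm \<phi>)"

definition recursive_lang :: "lang \<Rightarrow> bool" where
  "recursive_lang L \<longleftrightarrow>
     recursive_rel 2 {[f, k] | f k. (f, k) \<in> funs L} \<and>
     recursive_rel 2 {[r, k] | r k. (r, k) \<in> rels L}"

text \<open>A theory is given by its set of (non-logical) axioms.\<close>

definition RE_theory :: "lang \<Rightarrow> fm set \<Rightarrow> bool" where
  "RE_theory L T \<longleftrightarrow> recursive_lang L \<and> (\<forall>\<phi>\<in>T. sentence L \<phi>) \<and>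
     RE_rel 1 {[code_fm \<phi>] | \<phi>. \<phi> \<in> T}"

definition consistent :: "lang \<Rightarrow> fm set \<Rightarrow> bool" where
  "consistent L T \<longleftrightarrow> \<not> derives L T Falsum"


section \<open>The theory Num and its interpretations\<close>

text \<open>The constant \<open>0\<close> is \<open>Fn 0 []\<close>, and the successor of \<open>t\<close> is \<open>Fn 1 [t]\<close>.\<close>

definition num_lang :: lang where
  "num_lang = \<lparr>funs = {(0, 0), (1, 1)}, rels = {}\<rparr>"

fun numeral_tm :: "nat \<Rightarrow> tm" where
  "numeral_tm 0 = Fn 0 []"
| "numeral_tm (Suc k) = Fn 1 [numeral_tm k]"

definition Num :: "fm set" where
  "Num = {Neg (Eq (numeral_tm m) (numeral_tm n)) | m n. m \<noteq> n}"

text \<open>A (one-dimensional, parameter-free) translation of the language of \<open>Num\<close>: the domain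
  formula, the translation of \<open>x\<^sub>0 = x\<^sub>1\<close>, of \<open>0 = x\<^sub>0\<close>, and of \<open>S x\<^sub>0 = x\<^sub>1\<close>.\<close>

record num_transl =
  dom_fm :: fm
  eq_fm :: fm
  zero_fm :: fm
  succ_fm :: fm

definition translation :: "lang \<Rightarrow> num_transl \<Rightarrow> bool" where
  "translation L I \<longleftrightarrow>
     wf_fm L (dom_fm I) \<and> fv_fm (dom_fm I) \<subseteq> {0} \<and>
     wf_fm L (eq_fm I) \<and> fv_fm (eq_fm I) \<subseteq> {0, 1} \<and>
     wf_fm L (zero_fm I) \<and> fv_fm (zero_fm I) \<subseteq> {0} \<and>
     wf_fm L (succ_fm I) \<and> fv_fm (succ_fm I) \<subseteq> {0, 1}"

definition at1 :: "fm \<Rightarrow> nat \<Rightarrow> fm" where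
  "at1 \<phi> x = subst_fm (\<lambda>_. Var x) \<phi>"

definition at2 :: "fm \<Rightarrow> nat \<Rightarrow> nat \<Rightarrow> fm" where
  "at2 \<phi> x y = subst_fm (case_nat (Var x) (\<lambda>_. Var y)) \<phi>"

lemma size_subst_tm_Var [simp]: "size (subst_tm (\<lambda>x. Var (r x)) t) = size t"
proof (induction t)
  case (Fn f ts)
  then show ?case by (simp add: size_list_conv_sum_list o_def cong: map_cong)
qed simp

lemma size_lift_tm [simp]: "size (lift_tm t) = size t"
  by (simp add: lift_tm_def)

text \<open>\<open>graph_tr I t y\<close> translates the formula \<open>t = x\<^sub>y\<close>.  Nested terms are first unravelled, so
  that function symbols occur only in atoms \<open>0 = y\<close> and \<open>S x = y\<close> with variables \<open>x\<close>, \<open>y\<close>: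
  \<open>S t = y\<close> becomes \<open>\<exists>z. t = z \<and> S z = y\<close>, with \<open>z\<close> restricted to the domain.
  The last equation concerns terms that are not in the language of \<open>Num\<close>.\<close>

fun graph_tr :: "num_transl \<Rightarrow> tm \<Rightarrow> nat \<Rightarrow> fm" where
  "graph_tr I (Var x) y = at2 (eq_fm I) x y"
| "graph_tr I (Fn f []) y = at1 (zero_fm I) y"
| "graph_tr I (Fn f [Var x]) y = at2 (succ_fm I) x y"
| "graph_tr I (Fn f [Fn g ts]) y =
     Ex (Conj (at1 (dom_fm I) 0)
       (Conj (graph_tr I (lift_tm (Fn g ts)) 0) (at2 (succ_fm I) 0 (Suc y))))"
| "graph_tr I (Fn f (s # t # ts)) y = Falsum"

fun eq_tr :: "num_transl \<Rightarrow> tm \<Rightarrow> tm \<Rightarrow> fm" where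
  "eq_tr I s (Var y) = graph_tr I s y"
| "eq_tr I (Var x) (Fn g ts) = graph_tr I (Fn g ts) x"
| "eq_tr I (Fn f ss) (Fn g ts) =
     Ex (Conj (at1 (dom_fm I) 0)
       (Conj (graph_tr I (lift_tm (Fn f ss)) 0) (graph_tr I (lift_tm (Fn g ts)) 0)))"

fun fm_tr :: "num_transl \<Rightarrow> fm \<Rightarrow> fm" where
  "fm_tr I (Eq s t) = eq_tr I s t"
| "fm_tr I (Rel r ts) = Falsum"
| "fm_tr I Falsum = Falsum"
| "fm_tr I (Imp \<phi> \<psi>) = Imp (fm_tr I \<phi>) (fm_tr I \<psi>)"
| "fm_tr I (All \<phi>) = All (Imp (at1 (dom_fm I) 0) (fm_tr I \<phi>))"

text \<open>The calculus contains the logic of equality, so the (universally closed) equality axioms of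
  the language of \<open>Num\<close> are among the theorems of \<open>Num\<close> and need no separate clause.\<close>

definition interpretation_Num :: "lang \<Rightarrow> fm set \<Rightarrow> num_transl \<Rightarrow> bool" where
  "interpretation_Num L T I \<longleftrightarrow> translation L I \<and>
     derives L T (Ex (Conj (at1 (dom_fm I) 0) (at1 (zero_fm I) 0))) \<and>
     derives L T (All (Imp (at1 (dom_fm I) 0)
       (Ex (Conj (at1 (dom_fm I) 0) (at2 (succ_fm I) 1 0))))) \<and>
     (\<forall>\<phi>. sentence num_lang \<phi> \<and> derives num_lang Num \<phi> \<longrightarrow> derives L T (fm_tr I \<phi>))"

text \<open>\<open>is_num I a y\<close> expresses that the variable \<open>y\<close> is (in the domain and is) the value of the
  numeral of \<open>a\<close> under \<open>I\<close>.\<close>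

definition is_num :: "num_transl \<Rightarrow> nat \<Rightarrow> nat \<Rightarrow> fm" where
  "is_num I a y = Conj (at1 (dom_fm I) y) (fm_tr I (Eq (numeral_tm a) (Var y)))"

text \<open>As \<open>I\<close> translates function symbols by formulas, translated numerals are not terms of \<open>L\<close>,
  and substituting them for the variables \<open>0, \<dots>, n - 1\<close> of \<open>\<phi>\<close> is contextual:
  \<open>\<exists>x\<^sub>1 \<dots> x\<^sub>n. x\<^sub>1 = a\<^sub>1 \<and> \<dots> \<and> x\<^sub>n = a\<^sub>n \<and> \<phi>(x\<^sub>1, \<dots>, x\<^sub>n)\<close>.  In the result, the index of each
  remaining variable of \<open>\<phi>\<close> is decreased by \<open>n\<close>.\<close>

definition at_nums :: "num_transl \<Rightarrow> fm \<Rightarrow> nat list \<Rightarrow> fm" where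
  "at_nums I \<phi> as =
     (Ex ^^ length as) (Conj (Conj_list (map (\<lambda>i. is_num I (as ! i) i) [0..<length as])) \<phi>)"


section \<open>Separation, definability and Rosser properties\<close>

text \<open>The variables \<open>x\<^sub>1, \<dots>, x\<^sub>n\<close> are the indices \<open>0, \<dots>, n - 1\<close>.\<close>

definition strongly_separates ::
  "lang \<Rightarrow> fm set \<Rightarrow> num_transl \<Rightarrow> nat \<Rightarrow> fm \<Rightarrow> nat list set \<Rightarrow> nat list set \<Rightarrow> bool" where
  "strongly_separates L T I n \<phi> M1 M2 \<longleftrightarrow>
     wf_fm L \<phi> \<and> fv_fm \<phi> = {..<n} \<and>
     (\<forall>as\<in>tuples n.
        (as \<in> M1 \<longrightarrow> derives L T (at_nums I \<phi> as)) \<and>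
        (as \<in> M2 \<longrightarrow> derives L T (Neg (at_nums I \<phi> as))))"

definition exactly_separates ::
  "lang \<Rightarrow> fm set \<Rightarrow> num_transl \<Rightarrow> nat \<Rightarrow> fm \<Rightarrow> nat list set \<Rightarrow> nat list set \<Rightarrow> bool" where
  "exactly_separates L T I n \<phi> M1 M2 \<longleftrightarrow>
     wf_fm L \<phi> \<and> fv_fm \<phi> = {..<n} \<and>
     (\<forall>as\<in>tuples n.
        (as \<in> M1 \<longleftrightarrow> derives L T (at_nums I \<phi> as)) \<and>
        (as \<in> M2 \<longleftrightarrow> derives L T (Neg (at_nums I \<phi> as))))"

definition Rosser_via :: "lang \<Rightarrow> fm set \<Rightarrow> nat \<Rightarrow> num_transl \<Rightarrow> bool" where
  "Rosser_via L T n I \<longleftrightarrow> interpretation_Num L T I \<and>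
     (\<forall>M1 M2. RE_rel n M1 \<and> RE_rel n M2 \<longrightarrow>
        (\<exists>\<phi>. strongly_separates L T I n \<phi> (M1 - M2) (M2 - M1)))"

definition exact_Rosser :: "lang \<Rightarrow> fm set \<Rightarrow> nat \<Rightarrow> bool" where
  "exact_Rosser L T n \<longleftrightarrow> (\<exists>I. interpretation_Num L T I \<and>
     (\<forall>M1 M2. RE_rel n M1 \<and> RE_rel n M2 \<and> M1 \<inter> M2 = {} \<longrightarrow>
        (\<exists>\<phi>. exactly_separates L T I n \<phi> M1 M2)))"

text \<open>The variable \<open>y\<close> is the index \<open>n\<close> of \<open>\<phi>\<close>, hence the index 0 of \<open>at_nums I \<phi> as\<close>.\<close>

definition strongly_definable ::
  "lang \<Rightarrow> fm set \<Rightarrow> num_transl \<Rightarrow> nat \<Rightarrow> (nat list \<Rightarrow> nat list) \<Rightarrow> bool" where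
  "strongly_definable L T I n F \<longleftrightarrow>
     (\<forall>i<n. \<exists>\<phi>. wf_fm L \<phi> \<and> fv_fm \<phi> \<subseteq> {..n} \<and>
        (\<forall>as\<in>tuples n. derives L T (All (Iff (at_nums I \<phi> as) (is_num I (F as ! i) 0)))))"

end

theory Submission
  imports Defs
begin

text \<open>Provability in \<open>T\<close> is recursively enumerable: evaluation of recursive functions,
  substitution, well-formedness and the calculus are one finite Horn program over codes, and the
  least model of such a program is enumerated in stages.  So for disjoint RE relations \<open>M1\<close> and
  \<open>M2\<close>, the relations
  \<open>N1 = {(\<langle>e, a\<rangle>, r) | (a, r) \<in> M1 \<or> T \<turnstile> \<not> \<psi>\<^sub>e(\<langle>e, a\<rangle>, r)}\<close> and
  \<open>N2 = {(\<langle>e, a\<rangle>, r) | (a, r) \<in> M2 \<or> T \<turnstile> \<psi>\<^sub>e(\<langle>e, a\<rangle>, r)}\<close>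
  are RE, where \<open>e\<close> is the code of \<open>\<psi>\<^sub>e\<close>.  Let \<open>\<psi>\<close>, with code \<open>e\<close>, separate \<open>N1 - N2\<close> from
  \<open>N2 - N1\<close>.  If \<open>T\<close> proves \<open>\<psi>(\<langle>e, a\<rangle>, r)\<close>, then \<open>(\<langle>e, a\<rangle>, r)\<close> is in \<open>N2\<close>, so by consistency it is
  also in \<open>N1\<close>, that is, \<open>(a, r) \<in> M1\<close>; likewise for refutations and \<open>M2\<close>, and the converses hold by
  the choice of \<open>\<psi>\<close>.  Therefore the composition of \<open>\<psi>\<close> with the recursive functional
  \<open>(a, r) \<mapsto> (\<langle>e, a\<rangle>, r)\<close> separates \<open>M1\<close> and \<open>M2\<close> exactly.  That the formula expressing the
  composition is correct is checked in all Henkin sets (maximal consistent sets with witnesses).\<close>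


section \<open>Recursive functions\<close>

lemma recursive_funI:
  assumes "\<And>xs. length xs = n \<Longrightarrow> rec_eval f xs (g xs)"
    and "\<And>xs y. length xs = n \<Longrightarrow> rec_eval f xs y \<Longrightarrow> y = g xs"
  shows "recursive_fun n g"
  using assms unfolding recursive_fun_def tuples_def by blast

lemma recursive_fun_eqI:
  assumes "recursive_fun n f" and "\<And>xs. length xs = n \<Longrightarrow> f xs = g xs"
  shows "recursive_fun n g"
  using assms unfolding recursive_fun_def tuples_def by simp

lemma recursive_fun_zero: "recursive_fun n (\<lambda>_. 0)"
  by (rule recursive_funI[of _ Zero]) (auto intro: rec_eval.intros elim: rec_eval.cases)

lemma recursive_fun_nth: "i < n \<Longrightarrow> recursive_fun n (\<lambda>xs. xs ! i)"
  by (rule recursive_funI[of _ "Proj i"]) (auto intro: rec_eval.intros elim: rec_eval.cases)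

lemma recursive_fun_comp:
  assumes g: "recursive_fun m g" and h: "\<And>i. i < m \<Longrightarrow> recursive_fun n (h i)"
  shows "recursive_fun n (\<lambda>xs. g (map (\<lambda>i. h i xs) [0..<m]))"
proof -
  obtain f where f: "\<And>xs y. length xs = m \<Longrightarrow> rec_eval f xs y \<longleftrightarrow> y = g xs"
    using g unfolding recursive_fun_def tuples_def by blast
  have "\<forall>i. \<exists>k. i < m \<longrightarrow> (\<forall>xs y. length xs = n \<longrightarrow> rec_eval k xs y \<longleftrightarrow> y = h i xs)"
    using h unfolding recursive_fun_def tuples_def by blast
  then obtain k where
    k: "\<And>i xs y. i < m \<Longrightarrow> length xs = n \<Longrightarrow> rec_eval (k i) xs y \<longleftrightarrow> y = h i xs"
    by metis
  have all: "list_all2 (\<lambda>h y. rec_eval h xs y) (map k [0..<m]) ys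
      \<longleftrightarrow> ys = map (\<lambda>i. h i xs) [0..<m]" if "length xs = n" for xs ys
    using that k by (auto simp: list_all2_conv_all_nth intro!: nth_equalityI)
  show ?thesis
  proof (rule recursive_funI)
    fix xs :: "nat list" assume "length xs = n"
    with all show "rec_eval (Comp f (map k [0..<m])) xs (g (map (\<lambda>i. h i xs) [0..<m]))"
      by (intro rec_eval.Comp) (auto simp: f)
  next
    fix xs :: "nat list" and y assume "length xs = n"
      and "rec_eval (Comp f (map k [0..<m])) xs y"
    with all show "y = g (map (\<lambda>i. h i xs) [0..<m])"
      by (auto simp: f elim!: rec_eval.cases[of "Comp _ _"])
  qed
qed

lemma recursive_fun_comp1:
  assumes "recursive_fun 1 (\<lambda>xs. g (xs ! 0))" and "recursive_fun n f"
  shows "recursive_fun n (\<lambda>xs. g (f xs))"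
  using recursive_fun_comp[OF assms(1), of n "\<lambda>_. f"] assms(2) by simp

lemma recursive_fun_comp2:
  assumes "recursive_fun 2 (\<lambda>xs. g (xs ! 0) (xs ! 1))"
    and "recursive_fun n f1" and "recursive_fun n f2"
  shows "recursive_fun n (\<lambda>xs. g (f1 xs) (f2 xs))"
  using recursive_fun_comp[OF assms(1), of n "\<lambda>i. if i = 0 then f1 else f2"] assms(2,3)
  by (simp add: numeral_2_eq_2)

lemma recursive_fun_Suc:
  assumes "recursive_fun n f"
  shows "recursive_fun n (\<lambda>xs. Suc (f xs))"
proof (rule recursive_fun_comp1[OF _ assms], rule recursive_funI[of _ Succ])
  fix xs :: "nat list" assume "length xs = 1"
  then show "rec_eval Succ xs (Suc (xs ! 0))"
    by (cases xs) (auto intro: rec_eval.intros)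
qed (auto elim: rec_eval.cases)

lemma recursive_fun_const: "recursive_fun n (\<lambda>_. c)"
  by (induction c) (auto intro: recursive_fun_zero recursive_fun_Suc)

inductive_cases PrimRec_cases: "rec_eval (PrimRec f g) (k # xs) y"

text \<open>Phrasing the scheme through \<open>rec_nat\<close> reduces each later recursiveness
  proof to one equation between a \<open>rec_nat\<close> term and the intended operation.\<close>

lemma recursive_fun_primrec:
  assumes b: "recursive_fun n b"
    and s: "recursive_fun (Suc (Suc n)) (\<lambda>zs. s (zs ! 0) (zs ! 1) (drop 2 zs))"
  shows "recursive_fun (Suc n) (\<lambda>zs. rec_nat (b (tl zs)) (\<lambda>k y. s k y (tl zs)) (hd zs))"
proof -
  obtain f where f: "\<And>xs y. length xs = n \<Longrightarrow> rec_eval f xs y \<longleftrightarrow> y = b xs"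
    using b unfolding recursive_fun_def tuples_def by blast
  obtain g where g: "\<And>xs y. length xs = Suc (Suc n)
      \<Longrightarrow> rec_eval g xs y \<longleftrightarrow> y = s (xs ! 0) (xs ! 1) (drop 2 xs)"
    using s unfolding recursive_fun_def tuples_def by blast
  have ev: "rec_eval (PrimRec f g) (k # xs) y \<longleftrightarrow> y = rec_nat (b xs) (\<lambda>k y. s k y xs) k"
    if l: "length xs = n" for k xs y
  proof (induction k arbitrary: y)
    case 0
    have "rec_eval (PrimRec f g) (0 # xs) y \<longleftrightarrow> rec_eval f xs y"
      by (auto intro: rec_eval.PrimRec_0 elim: PrimRec_cases)
    then show ?case by (simp add: f l)
  next
    case (Suc k)
    have "rec_eval (PrimRec f g) (Suc k # xs) y
        \<longleftrightarrow> (\<exists>z. rec_eval (PrimRec f g) (k # xs) z \<and> rec_eval g (k # z # xs) y)"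
      by (auto intro: rec_eval.PrimRec_Suc elim: PrimRec_cases)
    then show ?case by (simp add: Suc g l)
  qed
  show ?thesis
  proof (rule recursive_funI[of _ "PrimRec f g"])
    fix zs :: "nat list" assume "length zs = Suc n"
    then obtain k xs where "zs = k # xs" "length xs = n"
      by (auto simp: length_Suc_conv)
    then show "rec_eval (PrimRec f g) zs (rec_nat (b (tl zs)) (\<lambda>k y. s k y (tl zs)) (hd zs))"
      by (simp add: ev)
  next
    fix zs :: "nat list" and y assume "length zs = Suc n" "rec_eval (PrimRec f g) zs y"
    then show "y = rec_nat (b (tl zs)) (\<lambda>k y. s k y (tl zs)) (hd zs)"
      by (cases zs) (simp_all add: ev)
  qed
qed

lemma recursive_fun_primrec1:
  assumes "recursive_fun 2 (\<lambda>zs. s (zs ! 0) (zs ! 1))" and "recursive_fun n f"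
  shows "recursive_fun n (\<lambda>xs. rec_nat b s (f xs))"
proof -
  have *: "recursive_fun 1 (\<lambda>zs. rec_nat b s (hd zs))"
    using recursive_fun_primrec[of 0 "\<lambda>_. b" "\<lambda>k y _. s k y"] assms(1)
    by (simp add: recursive_fun_const numeral_2_eq_2)
  have "recursive_fun 1 (\<lambda>zs. rec_nat b s (zs ! 0))"
    using * by (rule recursive_fun_eqI) (metis hd_conv_nth length_0_conv one_neq_zero)
  then show ?thesis
    by (rule recursive_fun_comp1[OF _ assms(2)])
qed

lemma recursive_fun_primrec2:
  assumes b: "recursive_fun 1 (\<lambda>xs. b (xs ! 0))"
    and s: "recursive_fun 3 (\<lambda>zs. s (zs ! 0) (zs ! 1) (zs ! 2))"
    and "recursive_fun n f" and "recursive_fun n g"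
  shows "recursive_fun n (\<lambda>xs. rec_nat (b (g xs)) (\<lambda>k y. s k y (g xs)) (f xs))"
proof -
  have *: "recursive_fun 2
      (\<lambda>zs. rec_nat (b (tl zs ! 0)) (\<lambda>k y. s k y (tl zs ! 0)) (hd zs))"
  proof -
    have "recursive_fun 3 (\<lambda>zs. s (zs ! 0) (zs ! 1) (drop 2 zs ! 0))"
      using s by (rule recursive_fun_eqI) simp
    with b show ?thesis
      using recursive_fun_primrec[of 1 "\<lambda>xs. b (xs ! 0)" "\<lambda>k y xs. s k y (xs ! 0)"]
      by (simp add: numeral_2_eq_2 numeral_3_eq_3)
  qed
  have "recursive_fun 2 (\<lambda>zs. rec_nat (b (zs ! 1)) (\<lambda>k y. s k y (zs ! 1)) (zs ! 0))"
    using * by (rule recursive_fun_eqI) (auto simp: numeral_2_eq_2 length_Suc_conv)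
  then show ?thesis
    using recursive_fun_comp2[OF _ assms(3,4),
      of "\<lambda>u v. rec_nat (b v) (\<lambda>k y. s k y v) u"] by simp
qed

lemmas recursive_fun_basic =
  recursive_fun_const recursive_fun_nth recursive_fun_Suc

lemma recursive_fun_add:
  assumes "recursive_fun n f" "recursive_fun n g"
  shows "recursive_fun n (\<lambda>xs. f xs + g xs)"
proof -
  have "rec_nat b (\<lambda>k y. Suc y) a = a + b" for a b
    by (induction a) auto
  then show ?thesis
    using recursive_fun_primrec2[OF _ _ assms, of "\<lambda>x. x" "\<lambda>k y x. Suc y"]
    by (simp add: recursive_fun_basic)
qed

lemma recursive_fun_diff:
  assumes "recursive_fun n f" "recursive_fun n g"
  shows "recursive_fun n (\<lambda>xs. f xs - g xs)"
proof -
  have pred: "recursive_fun m (\<lambda>xs. h xs - 1)" if "recursive_fun m h" for m h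
  proof -
    have "rec_nat 0 (\<lambda>k y. k) a = a - 1" for a
      by (cases a) auto
    then show ?thesis
      using recursive_fun_primrec1[of "\<lambda>k y. k" m h 0] that by (simp add: recursive_fun_basic)
  qed
  have "rec_nat b (\<lambda>k y. y - 1) a = b - a" for a b
    by (induction a) auto
  then show ?thesis
    using recursive_fun_primrec2[OF _ _ assms(2,1), of "\<lambda>x. x" "\<lambda>k y x. y - 1"] pred
    by (simp add: recursive_fun_basic)
qed

lemma recursive_fun_if0:
  assumes "recursive_fun n c" "recursive_fun n f" "recursive_fun n g"
  shows "recursive_fun n (\<lambda>xs. if c xs = 0 then f xs else g xs)"
proof -
  have mult: "recursive_fun m (\<lambda>xs. h xs * k xs)"
    if "recursive_fun m h" "recursive_fun m k" for m h k
  proof -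
    have "rec_nat 0 (\<lambda>_ y. y + b) a = a * b" for a b
      by (induction a) auto
    then show ?thesis
      using recursive_fun_primrec2[OF _ _ that, of "\<lambda>x. 0" "\<lambda>k y x. y + x"]
      by (simp add: recursive_fun_basic recursive_fun_add)
  qed
  \<comment> \<open>Truncated subtraction makes \<open>1 - c xs\<close> the indicator of
    \<open>c xs = 0\<close>, and \<open>1 - (1 - c xs)\<close> that of the opposite.\<close>
  have "recursive_fun n (\<lambda>xs. (1 - c xs) * f xs + (1 - (1 - c xs)) * g xs)"
    by (intro recursive_fun_add mult recursive_fun_diff assms recursive_fun_const)
  moreover have "(1 - c xs) * f xs + (1 - (1 - c xs)) * g xs
      = (if c xs = 0 then f xs else g xs)" for xs
    by auto
  ultimately show ?thesis by simp
qed

section \<open>Cantor pairing and its inverse\<close>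

lemma recursive_fun_triangle:
  assumes "recursive_fun n f"
  shows "recursive_fun n (\<lambda>xs. triangle (f xs))"
proof -
  have "rec_nat 0 (\<lambda>k y. y + Suc k) a = triangle a" for a
    by (induction a) auto
  then show ?thesis
    using recursive_fun_primrec1[OF _ assms, of "\<lambda>k y. y + Suc k" 0]
    by (simp add: recursive_fun_basic recursive_fun_add)
qed

lemma recursive_fun_pair:
  assumes "recursive_fun n f" "recursive_fun n g"
  shows "recursive_fun n (\<lambda>xs. prod_encode (f xs, g xs))"
  unfolding prod_encode_def
  by (simp add: recursive_fun_add recursive_fun_triangle assms)

text \<open>The diagonal of Cantor's pairing on which \<open>z\<close> lies, that is, the largest
  \<open>d\<close> with \<open>triangle d \<le> z\<close>. Counting up to \<open>z\<close>, it grows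
  exactly when the next triangular number is reached.\<close>

definition diagonal :: "nat \<Rightarrow> nat" where
  "diagonal = rec_nat 0 (\<lambda>k y. if triangle (Suc y) - Suc k = 0 then Suc y else y)"

lemma diagonal_bounds: "triangle (diagonal z) \<le> z \<and> z < triangle (Suc (diagonal z))"
  by (induction z) (auto simp: diagonal_def)

text \<open>The pair \<open>(a, b)\<close> has the code \<open>triangle (a + b) + a\<close>, which
  lies between two consecutive triangular numbers; monotonicity of \<open>triangle\<close> leaves
  only one such position.\<close>

lemma diagonal_eq: "diagonal z = fst (prod_decode z) + snd (prod_decode z)"
proof -
  obtain a b where ab: "prod_decode z = (a, b)" by fastforce
  then have z: "z = triangle (a + b) + a"
    using prod_decode_inverse[of z] unfolding ab by (simp add: prod_encode_def)
  have mono: "triangle i \<le> triangle j" if "i \<le> j" for i j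
    using that unfolding triangle_def by (intro div_le_mono mult_le_mono) simp_all
  have "\<not> diagonal z < a + b"
    using mono[of "Suc (diagonal z)" "a + b"] diagonal_bounds[of z] z by auto
  moreover have "\<not> a + b < diagonal z"
    using mono[of "Suc (a + b)" "diagonal z"] diagonal_bounds[of z] z by auto
  ultimately show ?thesis using ab by simp
qed

lemma recursive_fun_prod_decode:
  assumes "recursive_fun n f"
  shows "recursive_fun n (\<lambda>xs. fst (prod_decode (f xs)))"
    and "recursive_fun n (\<lambda>xs. snd (prod_decode (f xs)))"
proof -
  have d: "recursive_fun n (\<lambda>xs. diagonal (f xs))"
    unfolding diagonal_def
    by (intro recursive_fun_primrec1 recursive_fun_if0 recursive_fun_diff recursive_fun_triangle
        recursive_fun_basic assms) auto
  have *: "fst (prod_decode z) = z - triangle (diagonal z)" for z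
  proof -
    have "z = prod_encode (prod_decode z)" by simp
    also have "\<dots> = triangle (diagonal z) + fst (prod_decode z)"
      unfolding prod_encode_def diagonal_eq by (simp add: case_prod_beta)
    finally show ?thesis by simp
  qed
  show fst: "recursive_fun n (\<lambda>xs. fst (prod_decode (f xs)))"
    unfolding * by (intro recursive_fun_diff recursive_fun_triangle assms d)
  have "snd (prod_decode z) = diagonal z - fst (prod_decode z)" for z
    by (simp add: diagonal_eq)
  then show "recursive_fun n (\<lambda>xs. snd (prod_decode (f xs)))"
    by (simp add: recursive_fun_diff d fst)
qed

section \<open>Binary codes of finite sets\<close>

lemma recursive_fun_power2:
  assumes "recursive_fun n f"
  shows "recursive_fun n (\<lambda>xs. 2 ^ f xs)"
proof -
  have "rec_nat (1::nat) (\<lambda>k y. y + y) a = 2 ^ a" for a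
    by (induction a) auto
  then show ?thesis
    using recursive_fun_primrec1[OF _ assms, of "\<lambda>k y. y + y" 1]
    by (simp add: recursive_fun_basic recursive_fun_add)
qed

lemma recursive_fun_mod2:
  assumes "recursive_fun n f"
  shows "recursive_fun n (\<lambda>xs. f xs mod 2)"
proof -
  have "rec_nat 0 (\<lambda>k y. 1 - y) a = a mod 2" for a :: nat
    by (induction a) (auto simp: mod_Suc)
  then show ?thesis
    using recursive_fun_primrec1[OF _ assms, of "\<lambda>k y. 1 - y" 0]
    by (simp add: recursive_fun_basic recursive_fun_diff)
qed

lemma recursive_fun_shift:
  assumes "recursive_fun n f" "recursive_fun n g"
  shows "recursive_fun n (\<lambda>xs. f xs div 2 ^ g xs)"
proof -
  have half: "recursive_fun m (\<lambda>xs. h xs div 2)" if "recursive_fun m h" for m h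
  proof -
    \<comment> \<open>\<open>a div 2\<close> counts the odd numbers below \<open>a\<close>.\<close>
    have "rec_nat 0 (\<lambda>k y. y + k mod 2) a = a div 2" for a :: nat
      by (induction a) (simp_all, presburger)
    then show ?thesis
      using recursive_fun_primrec1[OF _ that, of "\<lambda>k y. y + k mod 2" 0]
      by (simp add: recursive_fun_basic recursive_fun_add recursive_fun_mod2)
  qed
  have "rec_nat b (\<lambda>k y. y div 2) a = b div 2 ^ a" for a b :: nat
    by (induction a) (simp_all add: div_mult2_eq[symmetric] mult.commute)
  then show ?thesis
    using recursive_fun_primrec2[OF _ _ assms(2,1), of "\<lambda>x. x" "\<lambda>k y x. y div 2"] half
    by (simp add: recursive_fun_basic)
qed

lemma recursive_fun_mem_set_decode:
  assumes "recursive_fun n f" "recursive_fun n g"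
  shows "recursive_fun n (\<lambda>xs. if f xs \<in> set_decode (g xs) then 1 else 0)"
proof -
  have "(if a \<in> set_decode b then 1 else 0) = b div 2 ^ a mod 2" for a b
    by (auto simp: set_decode_def odd_iff_mod_2_eq_one)
  then show ?thesis
    by (simp add: recursive_fun_mod2 recursive_fun_shift assms)
qed

lemma recursive_fun_list_encode:
  assumes "\<And>h. h \<in> set hs \<Longrightarrow> recursive_fun n h"
  shows "recursive_fun n (\<lambda>xs. list_encode (map (\<lambda>h. h xs) hs))"
  using assms by (induction hs) (simp_all add: recursive_fun_basic recursive_fun_pair)


section \<open>Horn programs over the natural numbers\<close>

text \<open>These are the terms of a logic program: variables, constants, successor and pairing.
  Atoms are numbers as well, with the predicate number paired in front of the arguments.\<close>

datatype pat = PV nat | PC nat | PS pat | PP pat pat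

primrec pev :: "(nat \<Rightarrow> nat) \<Rightarrow> pat \<Rightarrow> nat" where
  "pev \<sigma> (PV i) = \<sigma> i"
| "pev \<sigma> (PC c) = c"
| "pev \<sigma> (PS p) = Suc (pev \<sigma> p)"
| "pev \<sigma> (PP p q) = prod_encode (pev \<sigma> p, pev \<sigma> q)"

primrec pvars :: "pat \<Rightarrow> nat set" where
  "pvars (PV i) = {i}"
| "pvars (PC c) = {}"
| "pvars (PS p) = pvars p"
| "pvars (PP p q) = pvars p \<union> pvars q"

lemma finite_pvars: "finite (pvars p)"
  by (induction p) auto

lemma pev_cong: "(\<And>i. i \<in> pvars p \<Longrightarrow> \<sigma> i = \<tau> i) \<Longrightarrow> pev \<sigma> p = pev \<tau> p"
  by (induction p) auto

text \<open>A clause is a pair of head and body.\<close>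

type_synonym clause = "pat \<times> pat list"

text \<open>The least model of the program \<open>P\<close>; its variables range over all natural
  numbers.\<close>

inductive_set hset :: "clause list \<Rightarrow> nat set" for P :: "clause list" where
  clause: "(h, bs) \<in> set P \<Longrightarrow> (\<And>b. b \<in> set bs \<Longrightarrow> pev \<sigma> b \<in> hset P) \<Longrightarrow> pev \<sigma> h \<in> hset P"

text \<open>Iterated unpairing reads a number as an infinite sequence. So one number can serve as an
  assignment, and every finite part of an assignment is realised by some number.\<close>

primrec stream_nth :: "nat \<Rightarrow> nat \<Rightarrow> nat" where
  "stream_nth z 0 = fst (prod_decode z)"
| "stream_nth z (Suc i) = stream_nth (snd (prod_decode z)) i"

lemma stream_nth_exists: "\<exists>z. \<forall>i<m. stream_nth z i = \<sigma> i"
proof (induction m arbitrary: \<sigma>)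
  case (Suc m)
  obtain z where "\<forall>i<m. stream_nth z i = \<sigma> (Suc i)"
    using Suc[of "\<lambda>i. \<sigma> (Suc i)"] by auto
  then have "stream_nth (prod_encode (\<sigma> 0, z)) i = \<sigma> i" if "i < Suc m" for i
    using that by (cases i) auto
  then show ?case by blast
qed simp

text \<open>A stage is stored as a number whose binary digits mark the atoms derived so far. The
  test for non-membership ensures that adding the power of 2 sets a digit and never produces a
  carry.\<close>

definition fire :: "nat \<Rightarrow> clause \<Rightarrow> nat \<Rightarrow> nat" where
  "fire z c s = (if (\<forall>b\<in>set (snd c). pev (stream_nth z) b \<in> set_decode s)
       \<and> pev (stream_nth z) (fst c) \<notin> set_decode s
     then 2 ^ pev (stream_nth z) (fst c) + s else s)"

text \<open>Step \<open>k\<close> tries all clauses under the assignment coded by the first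
  component of \<open>k\<close>. The second component is free, so every assignment returns at
  arbitrarily late steps.\<close>

primrec stage :: "clause list \<Rightarrow> nat \<Rightarrow> nat" where
  "stage P 0 = 0"
| "stage P (Suc k) = fold (fire (fst (prod_decode k))) P (stage P k)"

lemma set_decode_fire:
  "set_decode (fire z c s) = (if \<forall>b\<in>set (snd c). pev (stream_nth z) b \<in> set_decode s
     then insert (pev (stream_nth z) (fst c)) (set_decode s) else set_decode s)"
  by (simp add: fire_def set_decode_plus_power_2 insert_absorb)

lemma fire_mono: "set_decode s \<subseteq> set_decode (fire z c s)"
  by (auto simp: set_decode_fire)

lemma fold_fire_mono: "set_decode s \<subseteq> set_decode (fold (fire z) cs s)"
  by (induction cs arbitrary: s) (use fire_mono in fastforce)+

lemma stage_mono: "j \<le> k \<Longrightarrow> set_decode (stage P j) \<subseteq> set_decode (stage P k)"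
  by (induction k rule: dec_induct) (use fold_fire_mono in fastforce)+

lemma stage_sound: "set_decode (stage P k) \<subseteq> hset P"
proof (induction k)
  case (Suc k)
  have "set_decode (fold (fire z) cs s) \<subseteq> hset P"
    if "set cs \<subseteq> set P" "set_decode s \<subseteq> hset P" for z cs s
    using that
  proof (induction cs arbitrary: s)
    case (Cons c cs)
    have "set_decode (fire z c s) \<subseteq> hset P"
      using Cons.prems hset.clause[of "fst c" "snd c" P "stream_nth z"]
      by (auto simp: set_decode_fire)
    with Cons show ?case by simp
  qed simp
  with Suc show ?case by simp
qed simp

lemma fold_fire_fires:
  assumes "c \<in> set cs" and "\<forall>b\<in>set (snd c). pev (stream_nth z) b \<in> set_decode s"
  shows "pev (stream_nth z) (fst c) \<in> set_decode (fold (fire z) cs s)"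
  using assms
proof (induction cs arbitrary: s)
  case (Cons d cs)
  show ?case
  proof (cases "c = d")
    case True
    then have "pev (stream_nth z) (fst c) \<in> set_decode (fire z d s)"
      using Cons.prems by (simp add: set_decode_fire)
    then show ?thesis using fold_fire_mono by fastforce
  next
    case False
    then show ?thesis using Cons fire_mono[of s z d] by auto
  qed
qed simp

text \<open>By induction, the finitely many body atoms are all present at some stage
  \<open>K\<close>; the clause then fires at a later step whose assignment agrees with
  \<open>\<sigma>\<close> on its variables.\<close>

lemma stage_complete: "x \<in> hset P \<Longrightarrow> \<exists>k. x \<in> set_decode (stage P k)"
proof (induction rule: hset.induct)
  case (clause h bs \<sigma>)
  obtain m where m: "pvars p \<subseteq> {..<m}" if "p \<in> insert h (set bs)" for p
  proof -
    have "finite (\<Union>p\<in>insert h (set bs). pvars p)"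
      by (simp add: finite_pvars)
    then obtain m where "\<forall>i\<in>(\<Union>p\<in>insert h (set bs). pvars p). i < m"
      unfolding finite_nat_set_iff_bounded by blast
    then show ?thesis by (intro that[of m]) auto
  qed
  obtain z where z: "\<forall>i<m. stream_nth z i = \<sigma> i"
    using stream_nth_exists by blast
  have ev: "pev (stream_nth z) p = pev \<sigma> p" if "p \<in> insert h (set bs)" for p
    using m[OF that] z by (intro pev_cong) auto
  have "\<exists>K. \<forall>b\<in>set bs. pev \<sigma> b \<in> set_decode (stage P K)"
  proof -
    obtain k where k: "\<And>b. b \<in> set bs \<Longrightarrow> pev \<sigma> b \<in> set_decode (stage P (k b))"
      using clause(3) by metis
    have "k b \<le> Max (k ` set bs)" if "b \<in> set bs" for b
      using that by simp
    then show ?thesis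
      using k stage_mono by blast
  qed
  then obtain K where K: "\<forall>b\<in>set bs. pev \<sigma> b \<in> set_decode (stage P K)" ..
  \<comment> \<open>This step does not come before \<open>K\<close>, because a pair code bounds its
    components, and its assignment is \<open>z\<close>.\<close>
  let ?k = "prod_encode (z, K)"
  have "\<forall>b\<in>set (snd (h, bs)). pev (stream_nth z) b \<in> set_decode (stage P ?k)"
    using K ev stage_mono[OF le_prod_encode_2[of K z], of P] by auto
  then have "pev (stream_nth z) h \<in> set_decode (stage P (Suc ?k))"
    using fold_fire_fires[OF clause(1)] by (simp)
  then show ?case using ev[of h] by (metis insertI1)
qed

lemma recursive_fun_pev_stream:
  assumes f: "recursive_fun n f"
  shows "recursive_fun n (\<lambda>xs. pev (stream_nth (f xs)) p)"
proof (induction p)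
  case (PV i)
  show ?case
    using f by (induction i arbitrary: f) (simp_all add: recursive_fun_prod_decode)
qed (simp_all add: recursive_fun_basic recursive_fun_pair)

lemma recursive_fun_fire:
  assumes f: "recursive_fun n f" and g: "recursive_fun n g"
  shows "recursive_fun n (\<lambda>xs. fire (f xs) c (g xs))"
proof -
  let ?mem = "\<lambda>b xs. if pev (stream_nth (f xs)) b \<in> set_decode (g xs) then 1 else 0 :: nat"
  let ?body = "\<lambda>bs xs. if \<forall>b\<in>set bs. pev (stream_nth (f xs)) b \<in> set_decode (g xs)
    then 1 else 0 :: nat"
  have mem: "recursive_fun n (?mem b)" for b
    by (intro recursive_fun_mem_set_decode recursive_fun_pev_stream f g)
  have body: "recursive_fun n (?body bs)" for bs
  proof (induction bs)
    case (Cons b bs)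
    have "recursive_fun n (\<lambda>xs. if ?mem b xs = 0 then 0 else ?body bs xs)"
      by (intro recursive_fun_if0 mem Cons.IH recursive_fun_const)
    then show ?case by (rule recursive_fun_eqI) simp
  qed (simp add: recursive_fun_const)
  have "recursive_fun n (\<lambda>xs. if ?body (snd c) xs = 0 then g xs else
      if ?mem (fst c) xs = 0 then 2 ^ pev (stream_nth (f xs)) (fst c) + g xs else g xs)"
    by (intro recursive_fun_if0 mem body g recursive_fun_add recursive_fun_power2
        recursive_fun_pev_stream f)
  then show ?thesis by (rule recursive_fun_eqI) (simp add: fire_def)
qed

lemma recursive_fun_stage:
  assumes "recursive_fun n f"
  shows "recursive_fun n (\<lambda>xs. stage P (f xs))"
proof -
  have fold: "recursive_fun m (\<lambda>xs. fold (fire (u xs)) cs (v xs))"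
    if "recursive_fun m u" "recursive_fun m v" for m u v cs
    using that by (induction cs arbitrary: v) (simp_all add: recursive_fun_fire)
  have "stage P = rec_nat 0 (\<lambda>k. fold (fire (fst (prod_decode k))) P)"
    by (rule ext, induct_tac x) auto
  then show ?thesis
    by (simp add: recursive_fun_primrec1 fold recursive_fun_prod_decode recursive_fun_nth assms)
qed

text \<open>Membership in the least model means membership in some stage, and stages are recursive,
  so an unbounded search over the stages semi-decides it. The stage is the added first argument, and
  \<open>tl\<close> removes it again.\<close>

theorem RE_hset:
  assumes g: "recursive_fun n g" and M: "\<And>xs. length xs = n \<Longrightarrow> xs \<in> M \<longleftrightarrow> g xs \<in> hset P"
    and "M \<subseteq> tuples n"
  shows "RE_rel n M"
proof -
  have tl: "recursive_fun (Suc n) (\<lambda>xs. g (tl xs))"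
  proof -
    have "recursive_fun (Suc n) (\<lambda>xs. g (map (\<lambda>i. xs ! Suc i) [0..<n]))"
      by (rule recursive_fun_comp[OF g]) (simp add: recursive_fun_nth)
    then show ?thesis
    proof (rule recursive_fun_eqI)
      fix xs :: "nat list" assume "length xs = Suc n"
      then have "map (\<lambda>i. xs ! Suc i) [0..<n] = tl xs"
        by (intro nth_equalityI) (auto simp: nth_tl)
      then show "g (map (\<lambda>i. xs ! Suc i) [0..<n]) = g (tl xs)" by simp
    qed
  qed
  \<comment> \<open>The indicator is inverted because \<open>Mu\<close> looks for the value 0 and
    requires positive values before it.\<close>
  have "recursive_fun (Suc n)
      (\<lambda>xs. 1 - (if g (tl xs) \<in> set_decode (stage P (xs ! 0)) then 1 else 0))"
    by (intro recursive_fun_diff recursive_fun_const recursive_fun_mem_set_decode tl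
        recursive_fun_stage recursive_fun_nth) simp
  then obtain f where f: "\<And>xs y. length xs = Suc n \<Longrightarrow> rec_eval f xs y
      \<longleftrightarrow> y = 1 - (if g (tl xs) \<in> set_decode (stage P (xs ! 0)) then 1 else 0)"
    unfolding recursive_fun_def tuples_def by blast
  then have f: "rec_eval f (k # xs) y
      \<longleftrightarrow> y = (if g xs \<in> set_decode (stage P k) then 0 else 1)" if "length xs = n" for k xs y
    using that by (simp)
  have "g xs \<in> hset P \<longleftrightarrow> (\<exists>y. rec_eval (Mu f) xs y)" if l: "length xs = n" for xs
  proof
    assume "g xs \<in> hset P"
    then have ex: "\<exists>k. g xs \<in> set_decode (stage P k)" by (rule stage_complete)
    have "rec_eval (Mu f) xs (LEAST k. g xs \<in> set_decode (stage P k))"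
    proof (rule rec_eval.Mu)
      show "rec_eval f ((LEAST k. g xs \<in> set_decode (stage P k)) # xs) 0"
        using LeastI_ex[OF ex] by (simp add: f l)
      show "\<forall>m<LEAST k. g xs \<in> set_decode (stage P k). \<exists>y. rec_eval f (m # xs) (Suc y)"
        using not_less_Least[of _ "\<lambda>k. g xs \<in> set_decode (stage P k)"]
        by (simp add: f l)
    qed
    then show "\<exists>y. rec_eval (Mu f) xs y" ..
  next
    assume "\<exists>y. rec_eval (Mu f) xs y"
    then obtain k where "rec_eval f (k # xs) 0"
      by (auto elim: rec_eval.cases[of "Mu _"])
    then have "g xs \<in> set_decode (stage P k)"
      by (simp add: f l split: if_splits)
    then show "g xs \<in> hset P" using stage_sound by blast
  qed
  then show ?thesis
    unfolding RE_rel_def using M assms(3) by (auto simp: tuples_def)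
qed


section \<open>Substitution\<close>

lemma subst_tm_cong: "(\<And>x. x \<in> fv_tm t \<Longrightarrow> \<sigma> x = \<tau> x) \<Longrightarrow> subst_tm \<sigma> t = subst_tm \<tau> t"
  by (induction t) auto

lemma subst_tm_Var: "subst_tm Var t = t"
  by (induction t) (auto intro: map_idI)

lemma subst_subst_tm: "subst_tm \<sigma> (subst_tm \<tau> t) = subst_tm (\<lambda>x. subst_tm \<sigma> (\<tau> x)) t"
  by (induction t) auto

lemma wf_subst_tm: "wf_tm L t \<Longrightarrow> (\<And>x. wf_tm L (\<sigma> x)) \<Longrightarrow> wf_tm L (subst_tm \<sigma> t)"
  by (induction t) auto

lemma fv_subst_tm: "fv_tm (subst_tm \<sigma> t) = (\<Union>x\<in>fv_tm t. fv_tm (\<sigma> x))"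
  by (induction t) auto

lemma finite_fv_tm: "finite (fv_tm t)"
  by (induction t) auto

lemma subst_lift_tm: "subst_tm \<sigma> (lift_tm t) = subst_tm (\<lambda>x. \<sigma> (Suc x)) t"
  by (simp add: lift_tm_def subst_subst_tm)

lemma wf_lift_tm: "wf_tm L t \<Longrightarrow> wf_tm L (lift_tm t)"
  by (simp add: lift_tm_def wf_subst_tm)

abbreviation up :: "(nat \<Rightarrow> tm) \<Rightarrow> nat \<Rightarrow> tm" where
  "up \<sigma> \<equiv> case_nat (Var 0) (\<lambda>x. lift_tm (\<sigma> x))"

lemma subst_fm_cong: "(\<And>x. x \<in> fv_fm \<phi> \<Longrightarrow> \<sigma> x = \<tau> x) \<Longrightarrow> subst_fm \<sigma> \<phi> = subst_fm \<tau> \<phi>"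
proof (induction \<phi> arbitrary: \<sigma> \<tau>)
  case (Eq s t)
  then show ?case by (simp add: subst_tm_cong[of _ \<sigma> \<tau>])
next
  case (Rel r ts)
  then show ?case by (auto intro!: subst_tm_cong)
next
  case (Imp \<phi> \<psi>)
  then show ?case by (metis UnCI fv_fm.simps(4) subst_fm.simps(4))
next
  case (All \<phi>)
  have "subst_fm (up \<sigma>) \<phi> = subst_fm (up \<tau>) \<phi>"
    using All.prems by (intro All.IH) (auto split: nat.splits)
  then show ?case by simp
qed simp

lemma subst_fm_Var: "subst_fm Var \<phi> = \<phi>"
proof (induction \<phi>)
  case (All \<phi>)
  have "up Var = Var" by (rule ext) (simp add: lift_tm_def split: nat.split)
  with All show ?case by simp
qed (auto simp: subst_tm_Var intro: map_idI)

lemma subst_subst_fm: "subst_fm \<sigma> (subst_fm \<tau> \<phi>) = subst_fm (\<lambda>x. subst_tm \<sigma> (\<tau> x)) \<phi>"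
proof (induction \<phi> arbitrary: \<sigma> \<tau>)
  case (All \<phi>)
  have "(\<lambda>x. subst_tm (up \<sigma>) (up \<tau> x)) = up (\<lambda>x. subst_tm \<sigma> (\<tau> x))"
    by (auto simp: lift_tm_def subst_subst_tm split: nat.splits)
  with All show ?case by simp
qed (auto simp: subst_subst_tm)

lemma wf_subst_fm: "wf_fm L \<phi> \<Longrightarrow> (\<And>x. wf_tm L (\<sigma> x)) \<Longrightarrow> wf_fm L (subst_fm \<sigma> \<phi>)"
  by (induction \<phi> arbitrary: \<sigma>) (auto simp: wf_subst_tm wf_lift_tm split: nat.splits)

lemma fv_subst_fm: "fv_fm (subst_fm \<sigma> \<phi>) = (\<Union>x\<in>fv_fm \<phi>. fv_tm (\<sigma> x))"
proof (induction \<phi> arbitrary: \<sigma>)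
  case (All \<phi>)
  show ?case
  proof (intro set_eqI iffI)
    fix y assume "y \<in> fv_fm (subst_fm \<sigma> (All \<phi>))"
    then obtain x where "x \<in> fv_fm \<phi>" "Suc y \<in> fv_tm (up \<sigma> x)"
      by (auto simp: All)
    then show "y \<in> (\<Union>x\<in>fv_fm (All \<phi>). fv_tm (\<sigma> x))"
      by (cases x) (auto simp: lift_tm_def fv_subst_tm)
  next
    fix y assume "y \<in> (\<Union>x\<in>fv_fm (All \<phi>). fv_tm (\<sigma> x))"
    then obtain x where "Suc x \<in> fv_fm \<phi>" "y \<in> fv_tm (\<sigma> x)" by auto
    then show "y \<in> fv_fm (subst_fm \<sigma> (All \<phi>))"
      by (auto simp: All lift_tm_def fv_subst_tm intro!: bexI[of _ "Suc x"])
  qed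
qed (auto simp: fv_subst_tm)

lemma finite_fv_fm: "finite (fv_fm \<phi>)"
proof (induction \<phi>)
  case (All \<phi>)
  have "{x. Suc x \<in> fv_fm \<phi>} = Suc -` fv_fm \<phi>" by auto
  with All show ?case by (simp add: finite_vimageI)
qed (auto simp: finite_fv_tm)

text \<open>The two substitutions merge into one that sends index 0 to \<open>t\<close>. This yields
  the quantifier case of truth in Henkin sets.\<close>

lemma inst_subst_up: "inst (subst_fm (up \<sigma>) \<phi>) t = subst_fm (case_nat t \<sigma>) \<phi>"
  unfolding inst_def subst_subst_fm
  by (intro subst_fm_cong) (auto simp: subst_lift_tm subst_tm_Var split: nat.splits)

lemma subst_inst: "subst_fm \<sigma> (inst \<phi> t) = inst (subst_fm (up \<sigma>) \<phi>) (subst_tm \<sigma> t)"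
  unfolding inst_subst_up unfolding inst_def subst_subst_fm
  by (intro subst_fm_cong) (auto split: nat.splits)

lemma subst_lift_fm: "subst_fm (up \<sigma>) (lift_fm \<phi>) = lift_fm (subst_fm \<sigma> \<phi>)"
  by (simp add: lift_fm_def subst_subst_fm lift_tm_def)

lemma wf_inst: "wf_fm L \<phi> \<Longrightarrow> wf_tm L t \<Longrightarrow> wf_fm L (inst \<phi> t)"
  unfolding inst_def by (rule wf_subst_fm) (auto split: nat.splits)

lemma subst_fm_sentence: "fv_fm \<phi> = {} \<Longrightarrow> subst_fm \<sigma> \<phi> = \<phi>"
  using subst_fm_cong[of \<phi> \<sigma> Var] by (simp add: subst_fm_Var)


section \<open>Henkin sets\<close>

lemma derives_wf:
  assumes "\<forall>\<phi>\<in>T. sentence L \<phi>"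
  shows "derives L T \<phi> \<Longrightarrow> wf_fm L \<phi>"
  by (induction rule: derives.induct)
    (use assms in \<open>auto simp: sentence_def wf_inst lift_fm_def wf_subst_fm\<close>)

text \<open>Axioms of \<open>T\<close> are sentences and hence unaffected, the logical schemes are
  closed under substitution, and generalization passes to \<open>up \<sigma>\<close>, so the
  induction is general in \<open>\<sigma>\<close>.\<close>

lemma derives_subst:
  assumes "\<forall>\<phi>\<in>T. sentence L \<phi>"
  shows "derives L T \<phi> \<Longrightarrow> (\<And>x. wf_tm L (\<sigma> x)) \<Longrightarrow> derives L T (subst_fm \<sigma> \<phi>)"
proof (induction arbitrary: \<sigma> rule: derives.induct)
  case (Axiom \<phi>)
  then show ?case
    using assms by (metis derives.Axiom sentence_def subst_fm_sentence)
next
  case (Ax_inst \<phi> t)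
  then have "wf_fm L (subst_fm (up \<sigma>) \<phi>)" "wf_tm L (subst_tm \<sigma> t)"
    by (auto intro!: wf_subst_fm wf_subst_tm simp: wf_lift_tm split: nat.splits)
  then show ?case by (simp add: subst_inst derives.Ax_inst)
next
  case (Ax_vac \<phi>)
  then show ?case by (simp add: subst_lift_fm derives.Ax_vac wf_subst_fm)
next
  case (Ax_dist \<phi> \<psi>)
  then have "wf_fm L (subst_fm (up \<sigma>) \<phi>)" "wf_fm L (subst_fm (up \<sigma>) \<psi>)"
    by (auto intro!: wf_subst_fm simp: wf_lift_tm split: nat.splits)
  then show ?case by (simp add: derives.Ax_dist)
next
  case (Ax_Leibniz \<phi> s t)
  then have "wf_fm L (subst_fm (up \<sigma>) \<phi>)" "wf_tm L (subst_tm \<sigma> s)" "wf_tm L (subst_tm \<sigma> t)"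
    by (auto intro!: wf_subst_fm wf_subst_tm simp: wf_lift_tm split: nat.splits)
  then show ?case by (simp add: subst_inst derives.Ax_Leibniz)
next
  case (MP \<phi> \<psi>)
  then show ?case by (metis derives.MP subst_fm.simps(4))
next
  case (Gen \<phi>)
  then have "derives L T (subst_fm (up \<sigma>) \<phi>)"
    by (auto intro!: Gen.IH simp: wf_lift_tm split: nat.splits)
  then show ?case by (simp add: derives.Gen)
qed (simp_all add: derives.intros wf_subst_fm wf_subst_tm)

text \<open>Generalization is available only inside theorems of \<open>T\<close>, never over
  hypotheses. Therefore the deduction theorem also holds for open hypotheses.\<close>

inductive entails :: "lang \<Rightarrow> fm set \<Rightarrow> fm set \<Rightarrow> fm \<Rightarrow> bool" for L T \<Gamma> where
  Thm: "derives L T \<phi> \<Longrightarrow> entails L T \<Gamma> \<phi>"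
| Hyp: "\<phi> \<in> \<Gamma> \<Longrightarrow> entails L T \<Gamma> \<phi>"
| MP: "entails L T \<Gamma> (Imp \<phi> \<psi>) \<Longrightarrow> entails L T \<Gamma> \<phi> \<Longrightarrow> entails L T \<Gamma> \<psi>"

lemma entails_mono: "entails L T \<Gamma> \<phi> \<Longrightarrow> \<Gamma> \<subseteq> \<Delta> \<Longrightarrow> entails L T \<Delta> \<phi>"
  by (induction rule: entails.induct) (auto intro: entails.intros)

lemma entails_empty: "entails L T {} \<phi> \<Longrightarrow> derives L T \<phi>"
  by (induction rule: entails.induct) (auto intro: derives.MP)

lemma entails_Union_chain:
  assumes "\<And>n. f n \<subseteq> f (Suc n)"
  shows "entails L T (\<Union>n::nat. f n) \<phi> \<Longrightarrow> \<exists>n. entails L T (f n) \<phi>"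
proof (induction rule: entails.induct)
  case (MP \<phi> \<psi>)
  then obtain m n where "entails L T (f m) (Imp \<phi> \<psi>)" "entails L T (f n) \<phi>" by blast
  moreover have "f m \<subseteq> f (max m n)" "f n \<subseteq> f (max m n)"
    using lift_Suc_mono_le[of f] assms by auto
  ultimately show ?case by (metis entails_mono entails.MP)
qed (auto intro: entails.intros)

text \<open>\<open>\<rho>\<close> turns the fresh variable into the bound index 0 and shifts all
  others, which undoes the instantiation.\<close>

lemma fresh_instance:
  assumes "x \<notin> fv_fm (All \<phi>)"
  defines "\<rho> \<equiv> \<lambda>y. if y = x then Var 0 else Var (Suc y)"
  shows "subst_fm \<rho> (inst \<phi> (Var x)) = \<phi>"
proof -
  have "subst_fm \<rho> (inst \<phi> (Var x)) = subst_fm Var \<phi>"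
    unfolding inst_def subst_subst_fm
    using assms by (intro subst_fm_cong) (auto split: nat.splits)
  then show ?thesis by (simp add: subst_fm_Var)
qed

context
  fixes L :: lang and T :: "fm set"
  assumes T: "\<forall>\<phi>\<in>T. sentence L \<phi>"
begin

lemma entails_wf: "entails L T \<Gamma> \<phi> \<Longrightarrow> \<forall>\<psi>\<in>\<Gamma>. wf_fm L \<psi> \<Longrightarrow> wf_fm L \<phi>"
  by (induction rule: entails.induct) (auto simp: derives_wf[OF T])

lemma deduction:
  assumes "entails L T (insert \<phi> \<Gamma>) \<psi>" and wf: "\<forall>\<psi>\<in>insert \<phi> \<Gamma>. wf_fm L \<psi>"
  shows "entails L T \<Gamma> (Imp \<phi> \<psi>)"
  using assms(1)
proof (induction rule: entails.induct)
  case (Thm \<psi>)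
  then show ?case
    using wf by (meson Ax_K derives_wf[OF T] entails.MP entails.Thm insertI1)
next
  case (Hyp \<psi>)
  show ?case
  proof (cases "\<psi> = \<phi>")
    case True
    have "derives L T (Imp \<phi> \<phi>)"
      using wf by (meson Ax_K Ax_S derives.MP insertI1 wf_fm.simps(4))
    with True show ?thesis by (simp add: entails.Thm)
  next
    case False
    with Hyp show ?thesis
      using wf by (meson Ax_K entails.Hyp entails.MP entails.Thm insertE insertI1)
  qed
next
  case (MP \<psi> \<chi>)
  then have "wf_fm L (Imp \<psi> \<chi>)" using entails_wf wf by blast
  then show ?case
    using MP.IH wf by (meson Ax_S entails.MP entails.Thm insertI1 wf_fm.simps(4))
qed

lemma entails_DN:
  assumes "entails L T (insert (Neg \<phi>) \<Gamma>) Falsum" "wf_fm L \<phi>" "\<forall>\<psi>\<in>\<Gamma>. wf_fm L \<psi>"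
  shows "entails L T \<Gamma> \<phi>"
  using deduction[OF assms(1)] assms(2,3)
  by (metis Ax_DN entails.MP entails.Thm insert_iff wf_fm.simps(3,4))

text \<open>Here a variable that is free in no hypothesis is generalized. On hypotheses
  \<open>\<rho>\<close> is mere lifting, so \<open>Ax_vac\<close> applies; \<open>Ax_dist\<close>
  carries modus ponens under the quantifier.\<close>

lemma entails_gen:
  assumes "entails L T \<Gamma> \<phi>" and wf: "\<forall>\<psi>\<in>\<Gamma>. wf_fm L \<psi>" and "\<forall>\<psi>\<in>\<Gamma>. x \<notin> fv_fm \<psi>"
  defines "\<rho> \<equiv> \<lambda>y. if y = x then Var 0 else Var (Suc y)"
  shows "entails L T \<Gamma> (All (subst_fm \<rho> \<phi>))"
proof -
  have \<rho>: "wf_tm L (\<rho> y)" for y by (simp add: \<rho>_def)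
  show ?thesis
    using assms(1)
  proof (induction rule: entails.induct)
    case (Thm \<phi>)
    then show ?case by (simp add: \<rho> entails.Thm derives.Gen derives_subst[OF T])
  next
    case (Hyp \<phi>)
    then have "subst_fm \<rho> \<phi> = lift_fm \<phi>"
      unfolding lift_fm_def \<rho>_def using assms(3) by (intro subst_fm_cong) auto
    with Hyp show ?case
      using wf by (metis Ax_vac entails.Hyp entails.MP entails.Thm)
  next
    case (MP \<phi> \<psi>)
    then have "wf_fm L (subst_fm \<rho> \<phi>)" "wf_fm L (subst_fm \<rho> \<psi>)"
      using entails_wf wf \<rho> by (meson wf_fm.simps(4) wf_subst_fm)+
    then show ?case using MP.IH by (metis Ax_dist entails.MP entails.Thm subst_fm.simps(4))
  qed
qed

lemma entails_All_fresh:
  assumes "entails L T \<Gamma> (inst \<phi> (Var x))" and "\<forall>\<psi>\<in>\<Gamma>. wf_fm L \<psi>"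
    and "\<forall>\<psi>\<in>\<Gamma>. x \<notin> fv_fm \<psi>" and "x \<notin> fv_fm (All \<phi>)"
  shows "entails L T \<Gamma> (All \<phi>)"
  using entails_gen[OF assms(1-3)] fresh_instance[OF assms(4)] by simp

end

text \<open>Members may be open formulas, and the intended domain consists of the terms of
  \<open>L\<close> themselves, variables included. The last clause makes quantifiers range over this
  domain.\<close>

definition henkin :: "lang \<Rightarrow> fm set \<Rightarrow> fm set \<Rightarrow> bool" where
  "henkin L T G \<longleftrightarrow> (\<forall>\<phi>. derives L T \<phi> \<longrightarrow> \<phi> \<in> G) \<and> Falsum \<notin> G \<and>
     (\<forall>\<phi> \<psi>. wf_fm L \<phi> \<and> wf_fm L \<psi> \<longrightarrow> (Imp \<phi> \<psi> \<in> G \<longleftrightarrow> (\<phi> \<in> G \<longrightarrow> \<psi> \<in> G))) \<and>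
     (\<forall>\<phi>. wf_fm L \<phi> \<longrightarrow> (All \<phi> \<in> G \<longleftrightarrow> (\<forall>t. wf_tm L t \<longrightarrow> inst \<phi> t \<in> G)))"

text \<open>Injectivity is assumed only at the entries of \<open>xs\<close>, which is what the
  induction hypothesis for a nested datatype provides.\<close>

lemma inj_list_encode_map:
  assumes "\<And>x. x \<in> set xs \<Longrightarrow> \<forall>y. f x = f y \<longrightarrow> x = y"
    and "list_encode (map f xs) = list_encode (map f ys)"
  shows "xs = ys"
proof -
  have "map f xs = map f ys" using assms(2) by (metis list_encode_inverse)
  then show ?thesis
    using assms(1) by (intro nth_equalityI) (metis length_map, metis length_map nth_map nth_mem)
qed

lemma code_tm_inj: "code_tm s = code_tm t \<longleftrightarrow> s = t"
proof -
  have "code_tm s = code_tm t \<longrightarrow> s = t"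
  proof (induction s arbitrary: t)
    case (Var x)
    show ?case by (cases t) auto
  next
    case (Fn f ss)
    then show ?case
      by (cases t) (auto intro: inj_list_encode_map)
  qed
  then show ?thesis by blast
qed

lemma code_tms_inj:
  "list_encode (map code_tm ss) = list_encode (map code_tm ts) \<longleftrightarrow> ss = ts"
  using inj_list_encode_map[of ss code_tm ts] by (auto simp: code_tm_inj)

lemma code_fm_inj: "code_fm \<phi> = code_fm \<psi> \<longleftrightarrow> \<phi> = \<psi>"
proof -
  have "code_fm \<phi> = code_fm \<psi> \<longrightarrow> \<phi> = \<psi>"
  proof (induction \<phi> arbitrary: \<psi>)
    case (Eq s t)
    show ?case by (cases \<psi>) (auto simp: code_tm_inj)
  next
    case (Rel r ts)
    show ?case by (cases \<psi>) (auto simp: code_tms_inj)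
  next
    case Falsum
    show ?case by (cases \<psi>) auto
  next
    case (Imp \<phi>1 \<phi>2)
    then show ?case by (cases \<psi>) auto
  next
    case (All \<phi>)
    then show ?case by (cases \<psi>) auto
  qed
  then show ?thesis by blast
qed

text \<open>Henkin's construction with variables as witnesses: starting from the negation of
  \<open>\<phi>\<close>, the formulas are decided one after another, and each accepted negated
  universal formula brings a refuted instance at a fresh variable.\<close>

lemma henkin_exists:
  assumes T: "\<forall>\<phi>\<in>T. sentence L \<phi>" and wf: "wf_fm L \<phi>" and not: "\<not> derives L T \<phi>"
  shows "\<exists>G. henkin L T G \<and> \<phi> \<notin> G"
proof -
  let ?con = "\<lambda>\<Gamma>. \<not> entails L T \<Gamma> Falsum"
  \<comment> \<open>Finitely many free variables always leave a fresh one as the next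
    witness.\<close>
  define good where
    "good \<Gamma> \<longleftrightarrow> finite (\<Union>(fv_fm ` \<Gamma>)) \<and> (\<forall>\<psi>\<in>\<Gamma>. wf_fm L \<psi>) \<and> ?con \<Gamma>" for \<Gamma>
  \<comment> \<open>The guard is there because \<open>inv code_fm\<close> also returns formulas
    outside the language, and arbitrary ones at numbers that are not codes.\<close>
  define decides where
    "decides \<Delta> \<chi> \<longleftrightarrow> wf_fm L \<chi> \<longrightarrow> Neg \<chi> \<in> \<Delta> \<or> \<chi> \<in> \<Delta> \<and>
      (\<forall>\<psi>. \<chi> = Neg (All \<psi>) \<longrightarrow> (\<exists>x. Neg (inst \<psi> (Var x)) \<in> \<Delta>))" for \<Delta> \<chi>
  have step: "\<exists>\<Delta>. good \<Delta> \<and> \<Gamma> \<subseteq> \<Delta> \<and> decides \<Delta> \<chi>" if good: "good \<Gamma>" for \<Gamma> \<chi>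
  proof (cases "wf_fm L \<chi> \<and> ?con (insert \<chi> \<Gamma>)")
    case False
    have "decides (insert (Neg \<chi>) \<Gamma>) \<chi>" by (simp add: decides_def)
    moreover have "good (insert (Neg \<chi>) \<Gamma>)" if "wf_fm L \<chi>"
    proof -
      from that False have "entails L T (insert \<chi> \<Gamma>) Falsum" by blast
      then have 1: "entails L T \<Gamma> (Neg \<chi>)"
        using deduction[OF T] good that by (auto simp: good_def)
      have "?con (insert (Neg \<chi>) \<Gamma>)"
      proof
        assume "entails L T (insert (Neg \<chi>) \<Gamma>) Falsum"
        then have "entails L T \<Gamma> \<chi>"
          using entails_DN[OF T] good that by (auto simp: good_def)
        with 1 have "entails L T \<Gamma> Falsum" by (rule entails.MP)
        with good show False by (simp add: good_def)
      qed
      with good that show ?thesis by (simp add: good_def finite_fv_fm)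
    qed
    ultimately show ?thesis
      using good by (cases "wf_fm L \<chi>") (auto simp: decides_def)
  next
    case True
    let ?\<Gamma> = "insert \<chi> \<Gamma>"
    from True good have good': "good ?\<Gamma>" by (simp add: good_def finite_fv_fm)
    show ?thesis
    proof (cases "\<exists>\<psi>. \<chi> = Neg (All \<psi>)")
      case False
      then have "decides ?\<Gamma> \<chi>" by (simp add: decides_def)
      with good' show ?thesis by blast
    next
      case ex: True
      then obtain \<psi> where \<chi>: "\<chi> = Neg (All \<psi>)" ..
      obtain x where x: "x \<notin> \<Union>(fv_fm ` ?\<Gamma>)"
        using good' unfolding good_def by (metis ex_new_if_finite infinite_UNIV_nat)
      have wfi: "wf_fm L (inst \<psi> (Var x))"
        using True \<chi> by (simp add: wf_inst)
      have "?con (insert (Neg (inst \<psi> (Var x))) ?\<Gamma>)"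
      proof
        assume "entails L T (insert (Neg (inst \<psi> (Var x))) ?\<Gamma>) Falsum"
        then have "entails L T ?\<Gamma> (inst \<psi> (Var x))"
          using entails_DN[OF T] good' wfi by (auto simp: good_def)
        then have "entails L T ?\<Gamma> (All \<psi>)"
          using x \<chi> good' by (intro entails_All_fresh[OF T]) (auto simp: good_def)
        moreover have "entails L T ?\<Gamma> (Neg (All \<psi>))"
          by (simp add: \<chi> entails.Hyp)
        ultimately have "entails L T ?\<Gamma> Falsum" by (metis entails.MP)
        with good' show False by (simp add: good_def)
      qed
      with good' wfi have "good (insert (Neg (inst \<psi> (Var x))) ?\<Gamma>)"
        by (simp add: good_def finite_fv_fm)
      moreover have "decides (insert (Neg (inst \<psi> (Var x))) ?\<Gamma>) \<chi>"
        by (auto simp: decides_def \<chi>)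
      ultimately show ?thesis by blast
    qed
  qed
  have "good {Neg \<phi>}"
  proof -
    have "?con {Neg \<phi>}"
      using entails_DN[OF T, of \<phi> "{}"] wf not entails_empty by blast
    with wf show ?thesis by (simp add: good_def finite_fv_fm)
  qed
  \<comment> \<open>Stage \<open>Suc n\<close> decides the formula with code \<open>n\<close>; as
    codes are injective, every formula gets its turn.\<close>
  then have "\<exists>f. \<forall>n. (good (f n) \<and> (n = 0 \<longrightarrow> f n = {Neg \<phi>})) \<and>
      (f n \<subseteq> f (Suc n) \<and> decides (f (Suc n)) (inv code_fm n))"
    using step by (intro dependent_nat_choice) auto
  then obtain f where f: "\<forall>n. (good (f n) \<and> (n = 0 \<longrightarrow> f n = {Neg \<phi>})) \<and>
      (f n \<subseteq> f (Suc n) \<and> decides (f (Suc n)) (inv code_fm n))" ..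
  from f have good: "\<And>n. good (f n)" and f0: "f 0 = {Neg \<phi>}"
    and chain: "\<And>n. f n \<subseteq> f (Suc n)" and dec: "\<And>n. decides (f (Suc n)) (inv code_fm n)"
    by simp_all
  define G where "G = (\<Union>n. f n)"
  have con: "?con G"
    using entails_Union_chain[of f, OF chain] good unfolding G_def good_def by blast
  have wfG: "\<forall>\<psi>\<in>G. wf_fm L \<psi>"
    using good by (auto simp: G_def good_def)
  have dec: "Neg \<chi> \<in> G \<or> \<chi> \<in> G \<and>
      (\<forall>\<psi>. \<chi> = Neg (All \<psi>) \<longrightarrow> (\<exists>x. Neg (inst \<psi> (Var x)) \<in> G))" if "wf_fm L \<chi>" for \<chi>
  proof -
    have "inv code_fm (code_fm \<chi>) = \<chi>"
      by (simp add: code_fm_inj inj_def)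
    then show ?thesis
      using dec[of "code_fm \<chi>"] that unfolding decides_def G_def by auto
  qed
  \<comment> \<open>A consequence of \<open>G\<close> cannot have its negation in \<open>G\<close>,
    so it was decided positively.\<close>
  have cl: "\<psi> \<in> G \<longleftrightarrow> entails L T G \<psi>" for \<psi>
  proof
    assume "entails L T G \<psi>"
    moreover from this have "Neg \<psi> \<notin> G"
      using con by (meson entails.Hyp entails.MP)
    ultimately show "\<psi> \<in> G"
      using dec entails_wf[OF T _ wfG] by blast
  qed (rule entails.Hyp)
  have Neg: "Neg \<psi> \<in> G \<longleftrightarrow> \<psi> \<notin> G" if "wf_fm L \<psi>" for \<psi>
    using con dec[OF that] cl by (meson entails.MP)
  have "henkin L T G"
    unfolding henkin_def
  proof (intro conjI allI impI)
    show "\<psi> \<in> G" if "derives L T \<psi>" for \<psi>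
      using that by (simp add: cl entails.Thm)
    show "Falsum \<notin> G" using con by (simp add: cl)
  next
    fix \<psi> \<chi> assume wf: "wf_fm L \<psi> \<and> wf_fm L \<chi>"
    have "Imp \<psi> \<chi> \<in> G" if "\<psi> \<in> G \<longrightarrow> \<chi> \<in> G"
    proof (cases "\<psi> \<in> G")
      case True
      with that have "entails L T (insert \<psi> G) \<chi>" by (simp add: entails.Hyp)
      then show ?thesis using deduction[OF T] wf wfG cl by auto
    next
      case False
      then have "entails L T (insert (Neg \<chi>) (insert \<psi> G)) Falsum"
        using Neg wf by (meson entails.Hyp entails.MP insertI1 insertI2)
      then have "entails L T (insert \<psi> G) \<chi>"
        using entails_DN[OF T] wf wfG by auto
      then show ?thesis using deduction[OF T] wf wfG cl by auto
    qed
    then show "Imp \<psi> \<chi> \<in> G \<longleftrightarrow> (\<psi> \<in> G \<longrightarrow> \<chi> \<in> G)"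
      using cl by (meson entails.MP)
  next
    fix \<psi> assume wf: "wf_fm L \<psi>"
    have "inst \<psi> t \<in> G" if "All \<psi> \<in> G" "wf_tm L t" for t
      using that wf cl by (meson Ax_inst entails.MP entails.Thm)
    moreover have "\<exists>x. inst \<psi> (Var x) \<notin> G" if "All \<psi> \<notin> G"
    proof -
      have "Neg (All \<psi>) \<in> G" using Neg[of "All \<psi>"] that wf by simp
      \<comment> \<open>With the double negation absent, \<open>dec\<close> must take its second
        alternative for \<open>Neg (All \<psi>)\<close>, which supplies the witness.\<close>
      then have "Neg (Neg (All \<psi>)) \<notin> G" using Neg[of "Neg (All \<psi>)"] wf by simp
      then obtain x where "Neg (inst \<psi> (Var x)) \<in> G"
        using dec[of "Neg (All \<psi>)"] wf by auto
      then show ?thesis using Neg[of "inst \<psi> (Var x)"] wf by (auto simp: wf_inst)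
    qed
    ultimately show "All \<psi> \<in> G \<longleftrightarrow> (\<forall>t. wf_tm L t \<longrightarrow> inst \<psi> t \<in> G)"
      by (metis wf_tm.simps(1))
  qed
  moreover have "\<phi> \<notin> G" using f0 Neg[OF wf] unfolding G_def by auto
  ultimately show ?thesis by blast
qed


text \<open>Completeness with Henkin sets as models: provability can be checked semantically instead
  of by explicit Hilbert derivations.\<close>

lemma derives_iff_henkin:
  assumes "\<forall>\<phi>\<in>T. sentence L \<phi>" and "wf_fm L \<phi>"
  shows "derives L T \<phi> \<longleftrightarrow> (\<forall>G. henkin L T G \<longrightarrow> \<phi> \<in> G)"
  using henkin_exists[OF assms] unfolding henkin_def by blast

section \<open>Truth in a Henkin set under an assignment of terms\<close>

definition wf_env :: "lang \<Rightarrow> (nat \<Rightarrow> tm) \<Rightarrow> bool" where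
  "wf_env L \<sigma> \<longleftrightarrow> (\<forall>x. wf_tm L (\<sigma> x))"

definition holds :: "fm set \<Rightarrow> (nat \<Rightarrow> tm) \<Rightarrow> fm \<Rightarrow> bool" where
  "holds G \<sigma> \<phi> \<longleftrightarrow> subst_fm \<sigma> \<phi> \<in> G"

definition prepend :: "tm list \<Rightarrow> (nat \<Rightarrow> tm) \<Rightarrow> nat \<Rightarrow> tm" where
  "prepend ts \<sigma> x = (if x < length ts then ts ! x else \<sigma> (x - length ts))"

lemma prepend_Nil [simp]: "prepend [] \<sigma> = \<sigma>"
  by (auto simp: prepend_def)

text \<open>The outermost quantifier of a block binds the highest index, so its value goes to the
  end of the list.\<close>

lemma prepend_snoc: "prepend ts (case_nat t \<sigma>) = prepend (ts @ [t]) \<sigma>"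
proof
  fix x
  show "prepend ts (case_nat t \<sigma>) x = prepend (ts @ [t]) \<sigma> x"
  proof (cases "length ts < x")
    case True
    then obtain k where "x = Suc (length ts + k)" using less_imp_Suc_add by blast
    then show ?thesis by (simp add: prepend_def)
  qed (auto simp: prepend_def nth_append)
qed

lemma wf_env_simps [simp]:
  "wf_env L Var"
  "wf_env L (\<lambda>_. t) \<longleftrightarrow> wf_tm L t"
  "wf_env L (case_nat t \<sigma>) \<longleftrightarrow> wf_tm L t \<and> wf_env L \<sigma>"
  by (auto simp: wf_env_def split: nat.splits)

lemma wf_env_prepend [simp]:
  "\<forall>t\<in>set ts. wf_tm L t \<Longrightarrow> wf_env L \<sigma> \<Longrightarrow> wf_env L (prepend ts \<sigma>)"
  by (auto simp: wf_env_def prepend_def)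

lemma wf_env_apply [simp]: "wf_env L \<sigma> \<Longrightarrow> wf_tm L (\<sigma> x)"
  by (simp add: wf_env_def)

lemma wf_Exn [simp]: "wf_fm L ((Ex ^^ n) \<phi>) \<longleftrightarrow> wf_fm L \<phi>"
  by (induction n) auto

lemma fv_Exn: "fv_fm ((Ex ^^ n) \<phi>) = {x. x + n \<in> fv_fm \<phi>}"
  by (induction n) auto

lemma wf_Conj_list [simp]: "wf_fm L (Conj_list \<phi>s) \<longleftrightarrow> (\<forall>\<phi>\<in>set \<phi>s. wf_fm L \<phi>)"
  by (induction \<phi>s) auto

lemma fv_Conj_list: "fv_fm (Conj_list \<phi>s) = (\<Union>\<phi>\<in>set \<phi>s. fv_fm \<phi>)"
  by (induction \<phi>s) auto

lemma holds_Var: "holds G Var \<phi> \<longleftrightarrow> \<phi> \<in> G"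
  by (simp add: holds_def subst_fm_Var)

lemma holds_cong: "(\<And>x. x \<in> fv_fm \<phi> \<Longrightarrow> \<sigma> x = \<tau> x) \<Longrightarrow> holds G \<sigma> \<phi> \<longleftrightarrow> holds G \<tau> \<phi>"
  unfolding holds_def by (metis subst_fm_cong)

lemma holds_subst: "holds G \<sigma> (subst_fm \<tau> \<phi>) \<longleftrightarrow> holds G (\<lambda>x. subst_tm \<sigma> (\<tau> x)) \<phi>"
  by (simp add: holds_def subst_subst_fm)

lemma holds_at1 [simp]: "holds G \<sigma> (at1 \<phi> x) \<longleftrightarrow> holds G (\<lambda>_. \<sigma> x) \<phi>"
  by (simp add: at1_def holds_subst)

lemma holds_at2 [simp]: "holds G \<sigma> (at2 \<phi> x y) \<longleftrightarrow> holds G (case_nat (\<sigma> x) (\<lambda>_. \<sigma> y)) \<phi>"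
  unfolding at2_def holds_subst by (rule holds_cong) (simp split: nat.split)

lemma wf_at1 [simp]: "wf_fm L \<phi> \<Longrightarrow> wf_fm L (at1 \<phi> x)"
  by (simp add: at1_def wf_subst_fm)

lemma wf_at2 [simp]: "wf_fm L \<phi> \<Longrightarrow> wf_fm L (at2 \<phi> x y)"
  unfolding at2_def by (rule wf_subst_fm) (auto split: nat.split)

lemma fv_at1: "fv_fm (at1 \<phi> x) \<subseteq> {x}"
  by (auto simp: at1_def fv_subst_fm)

lemma fv_at2: "fv_fm (at2 \<phi> x y) \<subseteq> {x, y}"
  by (auto simp: at2_def fv_subst_fm split: nat.splits)

locale henkin_set =
  fixes L :: lang and T G :: "fm set"
  assumes sentences: "\<forall>\<phi>\<in>T. sentence L \<phi>" and henkin: "henkin L T G"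
begin

lemma derives_in: "derives L T \<phi> \<Longrightarrow> \<phi> \<in> G"
  using henkin by (simp add: henkin_def)

lemma derives_holds: "derives L T \<phi> \<Longrightarrow> wf_env L \<sigma> \<Longrightarrow> holds G \<sigma> \<phi>"
  unfolding holds_def wf_env_def by (intro derives_in derives_subst sentences) auto

lemma holds_Falsum [simp]: "\<not> holds G \<sigma> Falsum"
  using henkin by (simp add: henkin_def holds_def)

lemma holds_Imp [simp]:
  "wf_fm L \<phi> \<Longrightarrow> wf_fm L \<psi> \<Longrightarrow> wf_env L \<sigma>
    \<Longrightarrow> holds G \<sigma> (Imp \<phi> \<psi>) \<longleftrightarrow> (holds G \<sigma> \<phi> \<longrightarrow> holds G \<sigma> \<psi>)"
  using henkin by (simp add: henkin_def holds_def wf_env_def wf_subst_fm)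

lemma holds_All [simp]:
  assumes "wf_fm L \<phi>" "wf_env L \<sigma>"
  shows "holds G \<sigma> (All \<phi>) \<longleftrightarrow> (\<forall>t. wf_tm L t \<longrightarrow> holds G (case_nat t \<sigma>) \<phi>)"
proof -
  have "wf_fm L (subst_fm (up \<sigma>) \<phi>)"
    using assms by (intro wf_subst_fm) (auto simp: wf_env_def wf_lift_tm split: nat.split)
  then show ?thesis
    using henkin by (simp add: henkin_def holds_def inst_subst_up)
qed

lemma holds_Exn [simp]:
  assumes "wf_fm L \<phi>" "wf_env L \<sigma>"
  shows "holds G \<sigma> ((Ex ^^ n) \<phi>) \<longleftrightarrow>
    (\<exists>ts. length ts = n \<and> (\<forall>t\<in>set ts. wf_tm L t) \<and> holds G (prepend ts \<sigma>) \<phi>)"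
  using assms
proof (induction n arbitrary: \<sigma>)
  case (Suc n)
  then have "holds G \<sigma> ((Ex ^^ Suc n) \<phi>) \<longleftrightarrow> (\<exists>t. wf_tm L t \<and> (\<exists>ts. length ts = n \<and>
      (\<forall>t\<in>set ts. wf_tm L t) \<and> holds G (prepend (ts @ [t]) \<sigma>) \<phi>))"
    by (auto simp: prepend_snoc)
  also have "\<dots> \<longleftrightarrow> (\<exists>ts. length ts = Suc n \<and> (\<forall>t\<in>set ts. wf_tm L t) \<and>
      holds G (prepend ts \<sigma>) \<phi>)"
  proof (intro iffI; elim exE conjE)
    fix t ts assume "wf_tm L t" "length ts = n" "\<forall>t\<in>set ts. wf_tm L t"
      "holds G (prepend (ts @ [t]) \<sigma>) \<phi>"
    then show "\<exists>ts. length ts = Suc n \<and> (\<forall>t\<in>set ts. wf_tm L t) \<and> holds G (prepend ts \<sigma>) \<phi>"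
      by (intro exI[of _ "ts @ [t]"]) auto
  next
    fix ts assume "length ts = Suc n" and ts: "\<forall>t\<in>set ts. wf_tm L t" "holds G (prepend ts \<sigma>) \<phi>"
    then obtain us t where "ts = us @ [t]" "length us = n"
      by (auto simp: length_Suc_conv_rev)
    with ts show "\<exists>t. wf_tm L t \<and> (\<exists>ts. length ts = n \<and> (\<forall>t\<in>set ts. wf_tm L t) \<and>
        holds G (prepend (ts @ [t]) \<sigma>) \<phi>)"
      by auto
  qed
  finally show ?case .
qed simp

lemma holds_Conj_list [simp]:
  "\<forall>\<phi>\<in>set \<phi>s. wf_fm L \<phi> \<Longrightarrow> wf_env L \<sigma>
    \<Longrightarrow> holds G \<sigma> (Conj_list \<phi>s) \<longleftrightarrow> (\<forall>\<phi>\<in>set \<phi>s. holds G \<sigma> \<phi>)"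
  by (induction \<phi>s) auto

lemma holds_Eq_refl [simp]: "wf_tm L t \<Longrightarrow> wf_env L \<sigma> \<Longrightarrow> holds G \<sigma> (Eq t t)"
  by (intro derives_holds Ax_refl)

lemma Leibniz:
  assumes "Eq s t \<in> G" "wf_tm L s" "wf_tm L t" "wf_fm L \<phi>" "inst \<phi> s \<in> G"
  shows "inst \<phi> t \<in> G"
proof -
  have "Imp (Eq s t) (Imp (inst \<phi> s) (inst \<phi> t)) \<in> G"
    using assms by (intro derives_in Ax_Leibniz)
  with assms show ?thesis
    using henkin by (simp add: henkin_def wf_inst)
qed

lemma Eq_sym: "Eq s t \<in> G \<Longrightarrow> wf_tm L s \<Longrightarrow> wf_tm L t \<Longrightarrow> Eq t s \<in> G"
  using Leibniz[of s t "Eq (Var 0) (lift_tm s)"]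
  by (simp add: wf_lift_tm inst_def subst_lift_tm subst_tm_Var derives_in Ax_refl)

lemma Eq_trans: "Eq s t \<in> G \<Longrightarrow> Eq t u \<in> G \<Longrightarrow> wf_tm L s \<Longrightarrow> wf_tm L t \<Longrightarrow> wf_tm L u
    \<Longrightarrow> Eq s u \<in> G"
  using Leibniz[of t u "Eq (lift_tm s) (Var 0)"]
  by (simp add: wf_lift_tm inst_def subst_lift_tm subst_tm_Var)

end


section \<open>Numerals under an interpretation\<close>

lemma subst_numeral [simp]: "subst_tm \<sigma> (numeral_tm a) = numeral_tm a"
  by (induction a) auto

lemma lift_numeral [simp]: "lift_tm (numeral_tm a) = numeral_tm a"
  by (simp add: lift_tm_def)

lemma fv_numeral [simp]: "fv_tm (numeral_tm a) = {}"
  by (induction a) auto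

lemma wf_numeral [simp]: "wf_tm num_lang (numeral_tm a)"
  by (induction a) (auto simp: num_lang_def)

text \<open>This sentence and the next are theorems of equality logic. An interpretation proves
  their translations, which is how the translated equality is known to determine and respect the
  values of numerals.\<close>

definition unique_numeral_fm :: "nat \<Rightarrow> fm" where
  "unique_numeral_fm a = All (All (Imp (Eq (numeral_tm a) (Var 0))
     (Imp (Eq (numeral_tm a) (Var 1)) (Eq (Var 1) (Var 0)))))"

definition numeral_cong_fm :: "nat \<Rightarrow> fm" where
  "numeral_cong_fm a = All (All (Imp (Eq (numeral_tm a) (Var 0))
     (Imp (Eq (Var 1) (Var 0)) (Eq (numeral_tm a) (Var 1)))))"

lemma sentence_numeral_fms:
  "sentence num_lang (unique_numeral_fm a)" "sentence num_lang (numeral_cong_fm a)"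
  by (auto simp: sentence_def unique_numeral_fm_def numeral_cong_fm_def)

lemma Num_sentence: "\<forall>\<phi>\<in>Num. sentence num_lang \<phi>"
  by (auto simp: Num_def sentence_def)

text \<open>Equality is symmetric and transitive in every Henkin set of \<open>Num\<close>, and
  completeness turns this into derivations.\<close>

lemma Num_derives_numeral_fms:
  "derives num_lang Num (unique_numeral_fm a)" "derives num_lang Num (numeral_cong_fm a)"
proof -
  have "unique_numeral_fm a \<in> G \<and> numeral_cong_fm a \<in> G" if "henkin num_lang Num G" for G
  proof -
    interpret henkin_set num_lang Num G
      using that Num_sentence by unfold_locales
    have "holds G Var (unique_numeral_fm a) \<and> holds G Var (numeral_cong_fm a)"
      unfolding unique_numeral_fm_def numeral_cong_fm_def
      by (auto simp: holds_def[of _ _ "Eq _ _"])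
        (meson Eq_sym Eq_trans wf_numeral)+
    then show ?thesis by (simp add: holds_Var)
  qed
  then show "derives num_lang Num (unique_numeral_fm a)" "derives num_lang Num (numeral_cong_fm a)"
    using derives_iff_henkin[OF Num_sentence] sentence_numeral_fms unfolding sentence_def by auto
qed

text \<open>Numerals are closed, so the lifting in \<open>graph_tr\<close> has no effect and all
  successor steps have the same shape.\<close>

lemma graph_tr_numeral_Suc:
  "graph_tr I (numeral_tm (Suc k)) y = Ex (Conj (at1 (dom_fm I) 0)
     (Conj (graph_tr I (numeral_tm k) 0) (at2 (succ_fm I) 0 (Suc y))))"
proof (cases k)
  case (Suc j)
  then show ?thesis using lift_numeral[of "Suc j"] by simp
qed (simp add: lift_tm_def)

lemma fv_graph_tr_numeral: "fv_fm (graph_tr I (numeral_tm a) y) \<subseteq> {y}"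
proof (induction a arbitrary: y)
  case 0
  show ?case using fv_at1 by simp
next
  case (Suc a)
  have "fv_fm (at1 (dom_fm I) 0) \<subseteq> {0}" "fv_fm (at2 (succ_fm I) 0 (Suc y)) \<subseteq> {0, Suc y}"
    using fv_at1 fv_at2 by blast+
  with Suc[of 0] show ?case
    unfolding graph_tr_numeral_Suc by auto
qed

lemma wf_graph_tr_numeral [simp]:
  "translation L I \<Longrightarrow> wf_fm L (graph_tr I (numeral_tm a) y)"
proof (induction a arbitrary: y)
  case (Suc a)
  then show ?case
    unfolding graph_tr_numeral_Suc by (simp add: translation_def del: numeral_tm.simps)
qed (simp add: translation_def)

lemma wf_is_num [simp]: "translation L I \<Longrightarrow> wf_fm L (is_num I a y)"
  by (simp add: is_num_def translation_def[of L I])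

locale henkin_interp = henkin_set +
  fixes I :: num_transl
  assumes interp: "interpretation_Num L T I"
begin

definition in_dom :: "tm \<Rightarrow> bool" where
  "in_dom u \<longleftrightarrow> holds G (\<lambda>_. u) (dom_fm I)"

definition eq_num :: "tm \<Rightarrow> tm \<Rightarrow> bool" where
  "eq_num u v \<longleftrightarrow> holds G (case_nat u (\<lambda>_. v)) (eq_fm I)"

definition eq_numeral :: "nat \<Rightarrow> tm \<Rightarrow> bool" where
  "eq_numeral a u \<longleftrightarrow> holds G (\<lambda>_. u) (graph_tr I (numeral_tm a) 0)"

definition num_val :: "nat \<Rightarrow> tm \<Rightarrow> bool" where
  "num_val a u \<longleftrightarrow> in_dom u \<and> eq_numeral a u"

lemma translation [simp]: "translation L I"
  using interp by (simp add: interpretation_Num_def)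

lemma wf_parts [simp]: "wf_fm L (dom_fm I)" "wf_fm L (eq_fm I)" "wf_fm L (succ_fm I)"
  using translation by (simp_all add: translation_def)

text \<open>At most \<open>y\<close> is free, so truth depends on nothing but its value and can be
  tested under a constant assignment.\<close>

lemma holds_graph_tr_numeral:
  assumes "wf_env L \<sigma>"
  shows "holds G \<sigma> (graph_tr I (numeral_tm a) y) \<longleftrightarrow> eq_numeral a (\<sigma> y)"
proof (cases a)
  case (Suc k)
  have "holds G (case_nat t \<tau>) (graph_tr I (numeral_tm k) 0)
      \<longleftrightarrow> holds G (\<lambda>_. t) (graph_tr I (numeral_tm k) 0)" for t \<tau>
    using fv_graph_tr_numeral[of I k 0] by (intro holds_cong) auto
  then show ?thesis
    using assms unfolding Suc graph_tr_numeral_Suc eq_numeral_def by (simp del: numeral_tm.simps)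
qed (simp add: eq_numeral_def)

lemma holds_is_num [simp]: "wf_env L \<sigma> \<Longrightarrow> holds G \<sigma> (is_num I a y) \<longleftrightarrow> num_val a (\<sigma> y)"
  by (simp add: is_num_def num_val_def in_dom_def holds_graph_tr_numeral)

text \<open>Both facts unfold the truth in \<open>G\<close> of a translated equality sentence; the
  outer quantifier supplies the value of index 1, the inner one that of index 0.\<close>

lemma numeral_theorems:
  assumes "wf_tm L u" "wf_tm L v"
  shows unique_num_val: "num_val a u \<Longrightarrow> num_val a v \<Longrightarrow> eq_num v u"
    and num_val_cong: "num_val a u \<Longrightarrow> in_dom v \<Longrightarrow> eq_num v u \<Longrightarrow> num_val a v"
proof -
  have unique: "holds G Var (fm_tr I (unique_numeral_fm a))"
    and cong: "holds G Var (fm_tr I (numeral_cong_fm a))"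
    using interp Num_derives_numeral_fms sentence_numeral_fms
    unfolding interpretation_Num_def by (blast intro: derives_holds wf_env_simps)+
  have "holds G Var (fm_tr I (unique_numeral_fm a)) \<longleftrightarrow>
      (\<forall>t. wf_tm L t \<longrightarrow> in_dom t \<longrightarrow> (\<forall>s. wf_tm L s \<longrightarrow> in_dom s \<longrightarrow>
      eq_numeral a s \<longrightarrow> eq_numeral a t \<longrightarrow> eq_num t s))"
    unfolding unique_numeral_fm_def by (simp add: in_dom_def eq_num_def holds_graph_tr_numeral)
  with unique show "num_val a u \<Longrightarrow> num_val a v \<Longrightarrow> eq_num v u"
    using assms unfolding num_val_def by blast
  have "holds G Var (fm_tr I (numeral_cong_fm a)) \<longleftrightarrow>
      (\<forall>t. wf_tm L t \<longrightarrow> in_dom t \<longrightarrow> (\<forall>s. wf_tm L s \<longrightarrow> in_dom s \<longrightarrow>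
      eq_numeral a s \<longrightarrow> eq_num t s \<longrightarrow> eq_numeral a t))"
    unfolding numeral_cong_fm_def by (simp add: in_dom_def eq_num_def holds_graph_tr_numeral)
  with cong show "num_val a u \<Longrightarrow> in_dom v \<Longrightarrow> eq_num v u \<Longrightarrow> num_val a v"
    using assms unfolding num_val_def by blast
qed

lemma holds_at_nums:
  assumes "wf_fm L \<phi>" "wf_env L \<sigma>"
  shows "holds G \<sigma> (at_nums I \<phi> as) \<longleftrightarrow> (\<exists>ts. length ts = length as \<and>
    (\<forall>t\<in>set ts. wf_tm L t) \<and> (\<forall>i<length as. num_val (as ! i) (ts ! i)) \<and>
    holds G (prepend ts \<sigma>) \<phi>)"
  unfolding at_nums_def using assms
  by (auto simp: prepend_def[of _ \<sigma> "_ :: nat"] cong: conj_cong)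

end


section \<open>Composition with a strongly definable functional\<close>

text \<open>Formulas defining \<open>F\<close> need not respect the translated equality, and the defining formulas
  of different components of \<open>F\<close> may hold for different representatives of the same numerals.
  Therefore \<open>component_fm\<close> closes the \<open>i\<close>-th of them under the translated equality.
  In \<open>compose_fm\<close>, the argument \<open>x\<^sub>j\<close> has index \<open>j\<close> outside of the quantifiers, and so index
  \<open>n + j\<close> in front of and \<open>2 n + j\<close> inside of \<open>component_fm\<close>.\<close>

definition component_fm :: "num_transl \<Rightarrow> nat \<Rightarrow> (nat \<Rightarrow> fm) \<Rightarrow> nat \<Rightarrow> fm" where
  "component_fm I n \<Phi> i = (Ex ^^ n) (Conj
     (Conj_list (map (\<lambda>j. Conj (at1 (dom_fm I) j) (at2 (eq_fm I) j (2 * n + j))) [0..<n]))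
     (subst_fm (\<lambda>k. if k < n then Var k else Var (n + i)) (\<Phi> i)))"

definition compose_fm :: "num_transl \<Rightarrow> nat \<Rightarrow> (nat \<Rightarrow> fm) \<Rightarrow> fm \<Rightarrow> fm" where
  "compose_fm I n \<Phi> \<psi> = Conj (Conj_list (map (\<lambda>j. Eq (Var j) (Var j)) [0..<n]))
     ((Ex ^^ n) (Conj (Conj_list (map (component_fm I n \<Phi>) [0..<n])) \<psi>))"

lemma wf_component_fm:
  "translation L I \<Longrightarrow> wf_fm L (\<Phi> i) \<Longrightarrow> wf_fm L (component_fm I n \<Phi> i)"
  by (auto simp: component_fm_def translation_def intro!: wf_subst_fm)

lemma wf_compose_fm:
  "translation L I \<Longrightarrow> \<forall>i<n. wf_fm L (\<Phi> i) \<Longrightarrow> wf_fm L \<psi> \<Longrightarrow> wf_fm L (compose_fm I n \<Phi> \<psi>)"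
  by (auto simp: compose_fm_def wf_component_fm)

text \<open>Inside the quantifier block, indices below \<open>n\<close> are the quantified
  representatives, those from \<open>n\<close> on are the values of the functional, and those from
  \<open>2 * n\<close> on are its arguments; the block removes the first \<open>n\<close>.\<close>

lemma fv_component_fm:
  assumes "i < n"
  shows "fv_fm (component_fm I n \<Phi> i) \<subseteq> {..<2 * n}"
proof -
  have "fv_fm (at1 (dom_fm I) j) \<subseteq> {j}" "fv_fm (at2 (eq_fm I) j (2 * n + j)) \<subseteq> {j, 2 * n + j}"
    for j
    using fv_at1 fv_at2 by blast+
  then have "fv_fm (Conj (at1 (dom_fm I) j) (at2 (eq_fm I) j (2 * n + j))) \<subseteq> {..<3 * n}"
    if "j < n" for j
    using that by fastforce
  then have "fv_fm (Conj_list (map (\<lambda>j. Conj (at1 (dom_fm I) j) (at2 (eq_fm I) j (2 * n + j)))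
      [0..<n])) \<subseteq> {..<3 * n}"
    unfolding fv_Conj_list by (simp add: UN_subset_iff)
  moreover have "fv_fm (subst_fm (\<lambda>k. if k < n then Var k else Var (n + i)) (\<Phi> i)) \<subseteq> {..<3 * n}"
    using assms by (auto simp: fv_subst_fm split: if_splits)
  ultimately have "fv_fm (Conj (Conj_list (map (\<lambda>j. Conj (at1 (dom_fm I) j)
      (at2 (eq_fm I) j (2 * n + j))) [0..<n]))
      (subst_fm (\<lambda>k. if k < n then Var k else Var (n + i)) (\<Phi> i))) \<subseteq> {..<3 * n}"
    by simp
  then show ?thesis
    unfolding component_fm_def fv_Exn by fastforce
qed

text \<open>The trivial equations in \<open>compose_fm\<close> make every argument occur. This gives
  equality with \<open>{..<n}\<close>, as the definition of separation demands.\<close>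

lemma fv_compose_fm:
  assumes "fv_fm \<psi> \<subseteq> {..<n}"
  shows "fv_fm (compose_fm I n \<Phi> \<psi>) = {..<n}"
proof -
  have "fv_fm (Conj (Conj_list (map (component_fm I n \<Phi>) [0..<n])) \<psi>) \<subseteq> {..<2 * n}"
    using assms fv_component_fm[of _ n I \<Phi>] by (fastforce simp: fv_Conj_list)
  then have "fv_fm ((Ex ^^ n) (Conj (Conj_list (map (component_fm I n \<Phi>) [0..<n])) \<psi>)) \<subseteq> {..<n}"
    unfolding fv_Exn by fastforce
  then show ?thesis
    unfolding compose_fm_def by (auto simp: fv_Conj_list)
qed

context henkin_interp
begin

lemma holds_component_fm:
  assumes wf: "wf_fm L (\<Phi> i)" "\<forall>t\<in>set xs. wf_tm L t" "\<forall>t\<in>set ys. wf_tm L t" "wf_env L \<sigma>"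
    and n: "length xs = n" "length ys = n" "i < n" and fv: "fv_fm (\<Phi> i) \<subseteq> {..n}"
  shows "holds G (prepend ys (prepend xs \<sigma>)) (component_fm I n \<Phi> i) \<longleftrightarrow>
    (\<exists>zs. length zs = n \<and> (\<forall>t\<in>set zs. wf_tm L t) \<and>
      (\<forall>j<n. in_dom (zs ! j) \<and> eq_num (zs ! j) (xs ! j)) \<and>
      holds G (prepend zs (case_nat (ys ! i) Var)) (\<Phi> i))"
proof -
  let ?\<tau> = "\<lambda>k. if k < n then Var k else Var (n + i)"
  have "wf_fm L (subst_fm ?\<tau> (\<Phi> i))"
    using wf by (intro wf_subst_fm) auto
  moreover have "holds G (prepend zs (prepend ys (prepend xs \<sigma>))) (subst_fm ?\<tau> (\<Phi> i))
      \<longleftrightarrow> holds G (prepend zs (case_nat (ys ! i) Var)) (\<Phi> i)" if "length zs = n" for zs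
    unfolding holds_subst using that n fv
    by (intro holds_cong) (auto simp: prepend_def split: nat.splits)
  ultimately show ?thesis
    unfolding component_fm_def using wf n
    by (auto simp: in_dom_def eq_num_def prepend_def[of _ _ "_ + _"] prepend_def[of zs _ j for zs j]
        cong: conj_cong)
qed

text \<open>Values of a numeral are unique up to the translated equality, and being a value is
  invariant under it. Hence component \<open>i\<close> holds of \<open>y\<close> exactly if
  \<open>y\<close> is a value of the numeral of \<open>bs ! i\<close>, whichever representatives of
  the arguments are used.\<close>

lemma holds_at_nums_compose_fm:
  assumes wf: "\<forall>i<n. wf_fm L (\<Phi> i)" "wf_fm L \<psi>" "wf_env L \<sigma>"
    and fv: "\<forall>i<n. fv_fm (\<Phi> i) \<subseteq> {..n}" "fv_fm \<psi> \<subseteq> {..<n}"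
    and n: "length as = n" "length bs = n" "n \<ge> 1"
    and def: "\<And>i. i < n \<Longrightarrow> derives L T (All (Iff (at_nums I (\<Phi> i) as) (is_num I (bs ! i) 0)))"
  shows "holds G \<sigma> (at_nums I (compose_fm I n \<Phi> \<psi>) as) \<longleftrightarrow> holds G \<sigma> (at_nums I \<psi> bs)"
proof -
  have wf_at_nums: "wf_fm L (at_nums I (\<Phi> i) as)" if "i < n" for i
    using that wf by (simp add: at_nums_def)
  have def: "(\<exists>zs. length zs = n \<and> (\<forall>t\<in>set zs. wf_tm L t) \<and> (\<forall>j<n. num_val (as ! j) (zs ! j)) \<and>
      holds G (prepend zs (case_nat y Var)) (\<Phi> i)) \<longleftrightarrow> num_val (bs ! i) y"
    if "i < n" "wf_tm L y" for i y
  proof -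
    have "holds G Var (All (Iff (at_nums I (\<Phi> i) as) (is_num I (bs ! i) 0)))"
      by (intro derives_holds def that wf_env_simps)
    then have "holds G (case_nat y Var) (Iff (at_nums I (\<Phi> i) as) (is_num I (bs ! i) 0))"
      by (rule holds_All[THEN iffD1, rule_format, rotated 2]) (simp_all add: wf_at_nums that)
    then have "holds G (case_nat y Var) (at_nums I (\<Phi> i) as) \<longleftrightarrow> num_val (bs ! i) y"
      using that by (simp add: wf_at_nums) blast
    then show ?thesis
      using that wf n by (simp add: holds_at_nums)
  qed
  have compose: "holds G (prepend xs \<sigma>) (compose_fm I n \<Phi> \<psi>) \<longleftrightarrow>
    (\<exists>ys. length ys = n \<and> (\<forall>t\<in>set ys. wf_tm L t) \<and>
      (\<forall>i<n. num_val (bs ! i) (ys ! i)) \<and> holds G (prepend ys \<sigma>) \<psi>)"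
    if xs: "length xs = n" "\<forall>t\<in>set xs. wf_tm L t" "\<forall>j<n. num_val (as ! j) (xs ! j)" for xs
  proof -
    have "holds G (prepend ys (prepend xs \<sigma>)) (component_fm I n \<Phi> i) \<longleftrightarrow> num_val (bs ! i) (ys ! i)"
      if ys: "length ys = n" "\<forall>t\<in>set ys. wf_tm L t" and i: "i < n" for ys i
    proof -
      have "num_val (as ! j) z \<longleftrightarrow> in_dom z \<and> eq_num z (xs ! j)" if "j < n" "wf_tm L z" for j z
        using that xs unique_num_val[of "xs ! j" z] num_val_cong[of "xs ! j" z]
        by (auto simp: num_val_def[of _ z])
      then show ?thesis
        using holds_component_fm[of \<Phi> i xs ys \<sigma> n] def[of i "ys ! i"] ys i xs wf fv
        by (auto cong: conj_cong)
    qed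
    moreover have "holds G (prepend ys (prepend xs \<sigma>)) \<psi> \<longleftrightarrow> holds G (prepend ys \<sigma>) \<psi>"
      if "length ys = n" for ys
      using that fv by (intro holds_cong) (auto simp: prepend_def)
    ultimately show ?thesis
      unfolding compose_fm_def using xs wf by (auto simp: wf_component_fm cong: conj_cong)
  qed
  \<comment> \<open>The composition also asserts that the arguments have values. They come from the
    defining formula of component 0, which exists as \<open>n \<ge> 1\<close>: a value of
    \<open>bs ! 0\<close> yields values of all of \<open>as\<close>.\<close>
  have reps: "\<exists>xs. length xs = n \<and> (\<forall>t\<in>set xs. wf_tm L t) \<and> (\<forall>j<n. num_val (as ! j) (xs ! j))"
    if "length ys = n" "\<forall>t\<in>set ys. wf_tm L t" "\<forall>i<n. num_val (bs ! i) (ys ! i)" for ys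
    using def[of 0 "ys ! 0"] that n by auto
  have "holds G \<sigma> (at_nums I (compose_fm I n \<Phi> \<psi>) as) \<longleftrightarrow>
      (\<exists>xs. length xs = n \<and> (\<forall>t\<in>set xs. wf_tm L t) \<and> (\<forall>j<n. num_val (as ! j) (xs ! j)) \<and>
        (\<exists>ys. length ys = n \<and> (\<forall>t\<in>set ys. wf_tm L t) \<and>
          (\<forall>i<n. num_val (bs ! i) (ys ! i)) \<and> holds G (prepend ys \<sigma>) \<psi>))"
    using wf n by (simp add: holds_at_nums wf_compose_fm compose cong: conj_cong)
  also have "\<dots> \<longleftrightarrow> holds G \<sigma> (at_nums I \<psi> bs)"
    using wf n reps by (simp add: holds_at_nums) blast
  finally show ?thesis .
qed

end

text \<open>Both formulas have the same truth value in every Henkin set; completeness transfers this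
  to provability and to refutability.\<close>

lemma derives_at_nums_compose_fm:
  assumes T: "\<forall>\<phi>\<in>T. sentence L \<phi>" and I: "interpretation_Num L T I"
    and wf: "\<forall>i<n. wf_fm L (\<Phi> i)" "wf_fm L \<psi>"
    and fv: "\<forall>i<n. fv_fm (\<Phi> i) \<subseteq> {..n}" "fv_fm \<psi> \<subseteq> {..<n}"
    and n: "length as = n" "length bs = n" "n \<ge> 1"
    and def: "\<And>i. i < n \<Longrightarrow> derives L T (All (Iff (at_nums I (\<Phi> i) as) (is_num I (bs ! i) 0)))"
  shows "derives L T (at_nums I (compose_fm I n \<Phi> \<psi>) as) \<longleftrightarrow> derives L T (at_nums I \<psi> bs)"
    and "derives L T (Neg (at_nums I (compose_fm I n \<Phi> \<psi>) as)) \<longleftrightarrow>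
      derives L T (Neg (at_nums I \<psi> bs))"
proof -
  have tr: "translation L I" using I by (simp add: interpretation_Num_def)
  have wfs: "wf_fm L (at_nums I (compose_fm I n \<Phi> \<psi>) as)" "wf_fm L (at_nums I \<psi> bs)"
    using wf tr by (simp_all add: at_nums_def wf_compose_fm)
  have eq: "holds G Var (at_nums I (compose_fm I n \<Phi> \<psi>) as) \<longleftrightarrow> holds G Var (at_nums I \<psi> bs)"
    "holds G Var (Neg (at_nums I (compose_fm I n \<Phi> \<psi>) as)) \<longleftrightarrow>
      holds G Var (Neg (at_nums I \<psi> bs))"
    if "henkin L T G" for G
  proof -
    interpret henkin_interp L T G I
      using that T I by unfold_locales
    show "holds G Var (at_nums I (compose_fm I n \<Phi> \<psi>) as) \<longleftrightarrow> holds G Var (at_nums I \<psi> bs)"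
      using wf fv n def by (intro holds_at_nums_compose_fm) auto
    then show "holds G Var (Neg (at_nums I (compose_fm I n \<Phi> \<psi>) as)) \<longleftrightarrow>
        holds G Var (Neg (at_nums I \<psi> bs))"
      using wfs by simp
  qed
  show "derives L T (at_nums I (compose_fm I n \<Phi> \<psi>) as) \<longleftrightarrow> derives L T (at_nums I \<psi> bs)"
    "derives L T (Neg (at_nums I (compose_fm I n \<Phi> \<psi>) as)) \<longleftrightarrow>
      derives L T (Neg (at_nums I \<psi> bs))"
    using eq wfs by (auto simp: derives_iff_henkin[OF T] holds_Var)
qed


section \<open>A Horn program for provability\<close>

text \<open>\<open>n\<close> and \<open>q\<close> build atoms with predicate number \<open>t\<close>, from numbers and from patterns;
  likewise \<open>c\<close> and \<open>p\<close> for the codes of formulas.\<close>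

abbreviation "n1 t a \<equiv> prod_encode (t, a)"
abbreviation "n2 t a b \<equiv> n1 t (prod_encode (a, b))"
abbreviation "n3 t a b c \<equiv> n2 t a (prod_encode (b, c))"
abbreviation "n4 t a b c d \<equiv> n3 t a b (prod_encode (c, d))"

abbreviation "q1 t a \<equiv> PP (PC t) a"
abbreviation "q2 t a b \<equiv> q1 t (PP a b)"
abbreviation "q3 t a b c \<equiv> q2 t a (PP b c)"
abbreviation "q4 t a b c d \<equiv> q3 t a b (PP c d)"
abbreviation "pcons a b \<equiv> PS (PP a b)"

abbreviation "pimp a b \<equiv> q2 3 a b"
abbreviation "pall a \<equiv> q1 4 a"
abbreviation "pneg a \<equiv> pimp a (PP (PC 2) (PC 0))"
abbreviation "pconj a b \<equiv> pneg (pimp a (pneg b))"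
abbreviation "pex a \<equiv> pneg (pall (pneg a))"

abbreviation "cimp a b \<equiv> n2 3 a b"
abbreviation "call a \<equiv> n1 4 a"
abbreviation "cneg a \<equiv> cimp a (prod_encode (2, 0))"
abbreviation "cconj a b \<equiv> cneg (cimp a (cneg b))"
abbreviation "cex a \<equiv> cneg (call (cneg a))"

text \<open>Descriptions become data, so that one fixed list of clauses evaluates all of them;
  particular functions enter later as constants.\<close>

fun code_recf :: "recf \<Rightarrow> nat" where
  "code_recf Zero = prod_encode (0, 0)"
| "code_recf Succ = prod_encode (1, 0)"
| "code_recf (Proj i) = prod_encode (2, i)"
| "code_recf (Comp g hs) = prod_encode (3, prod_encode (code_recf g, list_encode (map code_recf hs)))"
| "code_recf (PrimRec f g) = prod_encode (4, prod_encode (code_recf f, code_recf g))"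
| "code_recf (Mu f) = prod_encode (5, code_recf f)"

text \<open>The predicates are numbered as follows, with their arguments in the order of \<open>valid\<close>:
  0 list entry, 1 value of a recursive function, 2 values of a list of recursive functions,
  3 positive below a bound (for \<open>Mu\<close>), 4 value of a substitution at a variable,
  5--7 substitution in a term, a list of terms, a formula, 8 length of a list,
  9--11 well-formed term, list of terms, formula, 12 provable formula,
  13 \<open>graph_tr\<close> of a numeral, 14 \<open>is_num\<close>, 15 conjunction of such formulas,
  16 the relation to be enumerated.\<close>

definition rec_clauses :: "clause list" where
  "rec_clauses = [
    (q3 0 (pcons (PV 0) (PV 1)) (PC 0) (PV 0), []),
    (q3 0 (pcons (PV 0) (PV 1)) (PS (PV 2)) (PV 3), [q3 0 (PV 1) (PV 2) (PV 3)]),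
    (q3 1 (PP (PC 0) (PC 0)) (PV 0) (PC 0), []),
    (q3 1 (PP (PC 1) (PC 0)) (pcons (PV 0) (PC 0)) (PS (PV 0)), []),
    (q3 1 (PP (PC 2) (PV 0)) (PV 1) (PV 2), [q3 0 (PV 1) (PV 0) (PV 2)]),
    (q3 1 (PP (PC 3) (PP (PV 0) (PV 1))) (PV 2) (PV 3),
      [q3 2 (PV 1) (PV 2) (PV 4), q3 1 (PV 0) (PV 4) (PV 3)]),
    (q3 1 (PP (PC 4) (PP (PV 0) (PV 1))) (pcons (PC 0) (PV 2)) (PV 3),
      [q3 1 (PV 0) (PV 2) (PV 3)]),
    (q3 1 (PP (PC 4) (PP (PV 0) (PV 1))) (pcons (PS (PV 2)) (PV 3)) (PV 4),
      [q3 1 (PP (PC 4) (PP (PV 0) (PV 1))) (pcons (PV 2) (PV 3)) (PV 5),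
       q3 1 (PV 1) (pcons (PV 2) (pcons (PV 5) (PV 3))) (PV 4)]),
    (q3 1 (PP (PC 5) (PV 0)) (PV 1) (PV 2),
      [q3 1 (PV 0) (pcons (PV 2) (PV 1)) (PC 0), q3 3 (PV 0) (PV 2) (PV 1)]),
    (q3 2 (PC 0) (PV 0) (PC 0), []),
    (q3 2 (pcons (PV 0) (PV 1)) (PV 2) (pcons (PV 3) (PV 4)),
      [q3 1 (PV 0) (PV 2) (PV 3), q3 2 (PV 1) (PV 2) (PV 4)]),
    (q3 3 (PV 0) (PC 0) (PV 1), []),
    (q3 3 (PV 0) (PS (PV 1)) (PV 2),
      [q3 3 (PV 0) (PV 1) (PV 2), q3 1 (PV 0) (pcons (PV 1) (PV 2)) (PS (PV 3))])]"

text \<open>A substitution is passed as a list of term codes and a shift, as in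
  \<open>finite_subst\<close>. The last clause lifts this list by calling predicate 6 with the empty
  list and shift 1.\<close>

definition subst_clauses :: "clause list" where
  "subst_clauses = [
    (q4 4 (PC 0) (PV 0) (PC 0) (PP (PC 0) (PV 0)), []),
    (q4 4 (PC 0) (PV 0) (PS (PV 1)) (PP (PC 0) (PS (PV 2))),
      [q4 4 (PC 0) (PV 0) (PV 1) (PP (PC 0) (PV 2))]),
    (q4 4 (pcons (PV 0) (PV 1)) (PV 2) (PC 0) (PV 0), []),
    (q4 4 (pcons (PV 0) (PV 1)) (PV 2) (PS (PV 3)) (PV 4), [q4 4 (PV 1) (PV 2) (PV 3) (PV 4)]),
    (q4 5 (PV 0) (PV 1) (PP (PC 0) (PV 2)) (PV 3), [q4 4 (PV 0) (PV 1) (PV 2) (PV 3)]),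
    (q4 5 (PV 0) (PV 1) (q2 1 (PV 2) (PV 3)) (q2 1 (PV 2) (PV 4)),
      [q4 6 (PV 0) (PV 1) (PV 3) (PV 4)]),
    (q4 6 (PV 0) (PV 1) (PC 0) (PC 0), []),
    (q4 6 (PV 0) (PV 1) (pcons (PV 2) (PV 3)) (pcons (PV 4) (PV 5)),
      [q4 5 (PV 0) (PV 1) (PV 2) (PV 4), q4 6 (PV 0) (PV 1) (PV 3) (PV 5)]),
    (q4 7 (PV 0) (PV 1) (q2 0 (PV 2) (PV 3)) (q2 0 (PV 4) (PV 5)),
      [q4 5 (PV 0) (PV 1) (PV 2) (PV 4), q4 5 (PV 0) (PV 1) (PV 3) (PV 5)]),
    (q4 7 (PV 0) (PV 1) (q2 1 (PV 2) (PV 3)) (q2 1 (PV 2) (PV 4)),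
      [q4 6 (PV 0) (PV 1) (PV 3) (PV 4)]),
    (q4 7 (PV 0) (PV 1) (PP (PC 2) (PC 0)) (PP (PC 2) (PC 0)), []),
    (q4 7 (PV 0) (PV 1) (pimp (PV 2) (PV 3)) (pimp (PV 4) (PV 5)),
      [q4 7 (PV 0) (PV 1) (PV 2) (PV 4), q4 7 (PV 0) (PV 1) (PV 3) (PV 5)]),
    (q4 7 (PV 0) (PV 1) (pall (PV 2)) (pall (PV 3)),
      [q4 6 (PC 0) (PC 1) (PV 0) (PV 4),
       q4 7 (pcons (PP (PC 0) (PC 0)) (PV 4)) (PS (PV 1)) (PV 2) (PV 3)])]"

text \<open>The arity is the length of the argument list, and a symbol is accepted when
  \<open>fF\<close> or \<open>fR\<close> evaluates to 1; only this positive outcome enters the Horn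
  clauses.\<close>

definition wf_clauses :: "recf \<Rightarrow> recf \<Rightarrow> clause list" where
  "wf_clauses fF fR = [
    (q2 8 (PC 0) (PC 0), []),
    (q2 8 (pcons (PV 0) (PV 1)) (PS (PV 2)), [q2 8 (PV 1) (PV 2)]),
    (q1 9 (PP (PC 0) (PV 0)), []),
    (q1 9 (q2 1 (PV 0) (PV 1)), [q2 8 (PV 1) (PV 2),
      q3 1 (PC (code_recf fF)) (pcons (PV 0) (pcons (PV 2) (PC 0))) (PC 1), q1 10 (PV 1)]),
    (q1 10 (PC 0), []),
    (q1 10 (pcons (PV 0) (PV 1)), [q1 9 (PV 0), q1 10 (PV 1)]),
    (q1 11 (q2 0 (PV 0) (PV 1)), [q1 9 (PV 0), q1 9 (PV 1)]),
    (q1 11 (q2 1 (PV 0) (PV 1)), [q2 8 (PV 1) (PV 2),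
      q3 1 (PC (code_recf fR)) (pcons (PV 0) (pcons (PV 2) (PC 0))) (PC 1), q1 10 (PV 1)]),
    (q1 11 (PP (PC 2) (PC 0)), []),
    (q1 11 (pimp (PV 0) (PV 1)), [q1 11 (PV 0), q1 11 (PV 1)]),
    (q1 11 (pall (PV 0)), [q1 11 (PV 0)])]"

definition derives_clauses :: "recf \<Rightarrow> clause list" where
  "derives_clauses fT = [
    (q1 12 (PV 0), [q3 1 (PC (code_recf fT)) (pcons (PV 0) (PC 0)) (PV 1)]),
    (q1 12 (pimp (PV 0) (pimp (PV 1) (PV 0))), [q1 11 (PV 0), q1 11 (PV 1)]),
    (q1 12 (pimp (pimp (PV 0) (pimp (PV 1) (PV 2)))
        (pimp (pimp (PV 0) (PV 1)) (pimp (PV 0) (PV 2)))),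
      [q1 11 (PV 0), q1 11 (PV 1), q1 11 (PV 2)]),
    (q1 12 (pimp (pneg (pneg (PV 0))) (PV 0)), [q1 11 (PV 0)]),
    (q1 12 (pimp (pall (PV 0)) (PV 2)),
      [q1 11 (PV 0), q1 9 (PV 1), q4 7 (pcons (PV 1) (PC 0)) (PC 0) (PV 0) (PV 2)]),
    (q1 12 (pimp (pall (pimp (PV 0) (PV 1))) (pimp (pall (PV 0)) (pall (PV 1)))),
      [q1 11 (PV 0), q1 11 (PV 1)]),
    (q1 12 (pimp (PV 0) (pall (PV 1))), [q1 11 (PV 0), q4 7 (PC 0) (PC 1) (PV 0) (PV 1)]),
    (q1 12 (q2 0 (PV 0) (PV 0)), [q1 9 (PV 0)]),
    (q1 12 (pimp (q2 0 (PV 1) (PV 2)) (pimp (PV 3) (PV 4))),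
      [q1 11 (PV 0), q1 9 (PV 1), q1 9 (PV 2),
       q4 7 (pcons (PV 1) (PC 0)) (PC 0) (PV 0) (PV 3),
       q4 7 (pcons (PV 2) (PC 0)) (PC 0) (PV 0) (PV 4)]),
    (q1 12 (PV 1), [q1 12 (pimp (PV 0) (PV 1)), q1 12 (PV 0)]),
    (q1 12 (pall (PV 0)), [q1 12 (PV 0)])]"

definition graph_clauses :: "num_transl \<Rightarrow> clause list" where
  "graph_clauses I = [
    (q2 13 (PC 0) (PC (code_fm (at1 (zero_fm I) 0))), []),
    (q2 13 (PS (PV 0)) (pex (pconj (PC (code_fm (at1 (dom_fm I) 0)))
        (pconj (PV 1) (PC (code_fm (at2 (succ_fm I) 0 (Suc 0))))))), [q2 13 (PV 0) (PV 1)]),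
    (q3 15 (PV 0) (PC 0) (PC (code_fm (Neg Falsum))), [])]"

text \<open>The variable \<open>y\<close> occurs only in the outermost layer of
  \<open>is_num\<close>, while inner layers use variable 0. So predicate 13 serves every
  \<open>y\<close>, and each \<open>y\<close> adds only finitely many clauses.\<close>

definition is_num_clauses :: "num_transl \<Rightarrow> nat \<Rightarrow> clause list" where
  "is_num_clauses I y = [
    (q3 14 (PC y) (PC 0)
      (pconj (PC (code_fm (at1 (dom_fm I) y))) (PC (code_fm (at1 (zero_fm I) y)))), []),
    (q3 14 (PC y) (PS (PV 0)) (pconj (PC (code_fm (at1 (dom_fm I) y)))
        (pex (pconj (PC (code_fm (at1 (dom_fm I) 0)))
          (pconj (PV 1) (PC (code_fm (at2 (succ_fm I) 0 (Suc y)))))))), [q2 13 (PV 0) (PV 1)]),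
    (q3 15 (PC y) (pcons (PV 0) (PV 1)) (pconj (PV 2) (PV 3)),
      [q3 14 (PC y) (PV 0) (PV 2), q3 15 (PC (Suc y)) (PV 1) (PV 3)])]"

text \<open>The number \<open>PV 0\<close> is spliced in as if it were the code of a formula;
  predicate 12 then ensures that the whole is the code of a theorem.\<close>

definition goal_clauses :: "bool \<Rightarrow> nat \<Rightarrow> recf \<Rightarrow> clause list" where
  "goal_clauses neg n fA = [
    (q1 16 (pcons (PP (PV 0) (PV 1)) (PV 2)),
      [q3 1 (PC (code_recf fA)) (pcons (PV 1) (PV 2)) (PV 3)]),
    (q1 16 (pcons (PP (PV 0) (PV 1)) (PV 2)),
      [q3 15 (PC 0) (pcons (PP (PV 0) (PV 1)) (PV 2)) (PV 3),
       q1 12 ((if neg then pneg else id) ((pex ^^ n) (pconj (PV 3) (PV 0))))])]"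

text \<open>This class contains instantiation (\<open>[t]\<close> with shift 0) and lifting
  (\<open>[]\<close> with shift 1), and it is closed under passing below a quantifier.\<close>

fun finite_subst :: "tm list \<Rightarrow> nat \<Rightarrow> nat \<Rightarrow> tm" where
  "finite_subst [] m x = Var (x + m)"
| "finite_subst (t # ts) m 0 = t"
| "finite_subst (t # ts) m (Suc x) = finite_subst ts m x"

lemma lift_finite_subst: "finite_subst [] (Suc 0) = (\<lambda>x. Var (Suc x))"
  by (rule ext) simp

lemma inst_finite_subst: "inst \<phi> t = subst_fm (finite_subst [t] 0) \<phi>"
proof -
  have "case_nat t Var = finite_subst [t] 0"
    by (rule ext) (simp split: nat.split)
  then show ?thesis by (simp add: inst_def)
qed

lemma up_finite_subst: "up (finite_subst ts m) = finite_subst (Var 0 # map lift_tm ts) (Suc m)"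
proof
  have "lift_tm (finite_subst ts m x) = finite_subst (map lift_tm ts) (Suc m) x" for x
    by (induction ts m x rule: finite_subst.induct) (auto simp: lift_tm_def)
  then show "up (finite_subst ts m) x = finite_subst (Var 0 # map lift_tm ts) (Suc m) x" for x
    by (cases x) auto
qed

text \<open>The conjunction in \<open>at_nums\<close>, as a recursion over the list with the
  variable index as a counter; predicate 15 follows this recursion.\<close>

primrec numeral_conj :: "num_transl \<Rightarrow> nat \<Rightarrow> nat list \<Rightarrow> fm" where
  "numeral_conj I i [] = Neg Falsum"
| "numeral_conj I i (a # as) = Conj (is_num I a i) (numeral_conj I (Suc i) as)"

lemma numeral_conj_eq:
  "numeral_conj I i as = Conj_list (map (\<lambda>j. is_num I (as ! (j - i)) j) [i..<i + length as])"
proof (induction as arbitrary: i)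
  case (Cons a as)
  have *: "map (\<lambda>j. is_num I ((a # as) ! (j - i)) j) [Suc i..<Suc (i + length as)]
      = map (\<lambda>j. is_num I (as ! (j - Suc i)) j) [Suc i..<Suc (i + length as)]"
    by (intro map_cong refl) (auto simp: nth_Cons')
  show ?case by (simp add: Cons upt_conv_Cons * del: upt_Suc)
qed simp

lemma at_nums_numeral_conj:
  "at_nums I \<phi> as = (Ex ^^ length as) (Conj (numeral_conj I 0 as) \<phi>)"
  by (simp add: at_nums_def numeral_conj_eq)

lemma code_fm_Exn: "code_fm ((Ex ^^ n) \<phi>) = (cex ^^ n) (code_fm \<phi>)"
  by (induction n) auto

lemma pev_pexn: "pev \<sigma> ((pex ^^ n) p) = (cex ^^ n) (pev \<sigma> p)"
  by (induction n) auto

text \<open>The number \<open>e\<close> in the first entry \<open>\<langle>e, a\<rangle>\<close> is the code of a formula \<open>\<psi>\<close> that is evaluated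
  at the tuple itself.\<close>

definition diag_rel ::
  "lang \<Rightarrow> fm set \<Rightarrow> num_transl \<Rightarrow> bool \<Rightarrow> nat \<Rightarrow> nat list set \<Rightarrow> nat list set" where
  "diag_rel L T I neg n A = {xs \<in> tuples n. \<exists>e a r. xs = prod_encode (e, a) # r \<and>
     (a # r \<in> A \<or> (\<exists>\<phi>. derives L T \<phi> \<and> code_fm \<phi> =
       (if neg then cneg else id) ((cex ^^ n) (cconj (code_fm (numeral_conj I 0 xs)) e))))}"

text \<open>Injectivity of \<open>code_fm\<close> turns the condition on numbers into provability of
  \<open>\<psi>\<close>, or of its negation, at the tuple that carries the code of
  \<open>\<psi>\<close> itself.\<close>

lemma diag_rel_iff:
  assumes "length (a # r) = n"
  shows "prod_encode (code_fm \<psi>, a) # r \<in> diag_rel L T I neg n A \<longleftrightarrow> a # r \<in> A \<or>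
    derives L T ((if neg then Neg else id) (at_nums I \<psi> (prod_encode (code_fm \<psi>, a) # r)))"
proof -
  let ?xs = "prod_encode (code_fm \<psi>, a) # r"
  have "(if neg then cneg else id) ((cex ^^ n) (cconj (code_fm (numeral_conj I 0 ?xs)) (code_fm \<psi>)))
      = code_fm ((if neg then Neg else id) (at_nums I \<psi> ?xs))"
    using assms by (simp only: at_nums_numeral_conj length_Cons) (simp add: code_fm_Exn)
  with assms show ?thesis
    by (auto simp: diag_rel_def tuples_def code_fm_inj)
qed

text \<open>For codes that are arguments of a function, \<open>valid\<close> only makes a claim about those numbers
  that are codes of something.\<close>

abbreviation "uncode f v \<equiv> case_prod f (prod_decode v)"

definition valid :: "lang \<Rightarrow> fm set \<Rightarrow> num_transl \<Rightarrow> nat list set \<Rightarrow> nat \<Rightarrow> bool" where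
  "valid L T I M = uncode (\<lambda>t. [
    uncode (\<lambda>xs. uncode (\<lambda>i y. i < length (list_decode xs) \<and> list_decode xs ! i = y)),
    uncode (\<lambda>f. uncode (\<lambda>xs y. \<forall>F. f = code_recf F \<longrightarrow> rec_eval F (list_decode xs) y)),
    uncode (\<lambda>hs. uncode (\<lambda>xs ys. \<forall>HS. hs = list_encode (map code_recf HS) \<longrightarrow>
      list_all2 (\<lambda>h y. rec_eval h (list_decode xs) y) HS (list_decode ys))),
    uncode (\<lambda>f. uncode (\<lambda>k xs. \<forall>F. f = code_recf F \<longrightarrow>
      (\<forall>m<k. \<exists>y. rec_eval F (m # list_decode xs) (Suc y)))),
    uncode (\<lambda>ts. uncode (\<lambda>m. uncode (\<lambda>x d. \<forall>TS. ts = list_encode (map code_tm TS) \<longrightarrow>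
      d = code_tm (finite_subst TS m x)))),
    uncode (\<lambda>ts. uncode (\<lambda>m. uncode (\<lambda>c d. \<forall>TS t. ts = list_encode (map code_tm TS) \<longrightarrow>
      c = code_tm t \<longrightarrow> d = code_tm (subst_tm (finite_subst TS m) t)))),
    uncode (\<lambda>ts. uncode (\<lambda>m. uncode (\<lambda>c d. \<forall>TS us. ts = list_encode (map code_tm TS) \<longrightarrow>
      c = list_encode (map code_tm us) \<longrightarrow>
      d = list_encode (map code_tm (map (subst_tm (finite_subst TS m)) us))))),
    uncode (\<lambda>ts. uncode (\<lambda>m. uncode (\<lambda>c d. \<forall>TS \<phi>. ts = list_encode (map code_tm TS) \<longrightarrow>
      c = code_fm \<phi> \<longrightarrow> d = code_fm (subst_fm (finite_subst TS m) \<phi>)))),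
    uncode (\<lambda>l k. length (list_decode l) = k),
    (\<lambda>c. \<exists>t. c = code_tm t \<and> wf_tm L t),
    (\<lambda>c. \<exists>ts. c = list_encode (map code_tm ts) \<and> (\<forall>t\<in>set ts. wf_tm L t)),
    (\<lambda>c. \<exists>\<phi>. c = code_fm \<phi> \<and> wf_fm L \<phi>),
    (\<lambda>c. \<exists>\<phi>. c = code_fm \<phi> \<and> derives L T \<phi>),
    uncode (\<lambda>a c. c = code_fm (graph_tr I (numeral_tm a) 0)),
    uncode (\<lambda>y. uncode (\<lambda>a c. c = code_fm (is_num I a y))),
    uncode (\<lambda>i. uncode (\<lambda>xs c. c = code_fm (numeral_conj I i (list_decode xs)))),
    (\<lambda>xs. list_decode xs \<in> M)] ! t)"

lemma valid_simps [simp]: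
  "valid L T I M (n3 0 xs i y) \<longleftrightarrow> i < length (list_decode xs) \<and> list_decode xs ! i = y"
  "valid L T I M (n3 (Suc 0) f xs y) \<longleftrightarrow> (\<forall>F. f = code_recf F \<longrightarrow> rec_eval F (list_decode xs) y)"
  "valid L T I M (n3 2 hs xs ys) \<longleftrightarrow> (\<forall>HS. hs = list_encode (map code_recf HS) \<longrightarrow>
      list_all2 (\<lambda>h y. rec_eval h (list_decode xs) y) HS (list_decode ys))"
  "valid L T I M (n3 3 f k xs) \<longleftrightarrow> (\<forall>F. f = code_recf F \<longrightarrow>
      (\<forall>m<k. \<exists>y. rec_eval F (m # list_decode xs) (Suc y)))"
  "valid L T I M (n4 4 ts m x d) \<longleftrightarrow> (\<forall>TS. ts = list_encode (map code_tm TS) \<longrightarrow>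
      d = code_tm (finite_subst TS m x))"
  "valid L T I M (n4 5 ts m c d) \<longleftrightarrow> (\<forall>TS t. ts = list_encode (map code_tm TS) \<longrightarrow>
      c = code_tm t \<longrightarrow> d = code_tm (subst_tm (finite_subst TS m) t))"
  "valid L T I M (n4 6 ts m c d) \<longleftrightarrow> (\<forall>TS us. ts = list_encode (map code_tm TS) \<longrightarrow>
      c = list_encode (map code_tm us) \<longrightarrow>
      d = list_encode (map code_tm (map (subst_tm (finite_subst TS m)) us)))"
  "valid L T I M (n4 7 ts m c d) \<longleftrightarrow> (\<forall>TS \<phi>. ts = list_encode (map code_tm TS) \<longrightarrow>
      c = code_fm \<phi> \<longrightarrow> d = code_fm (subst_fm (finite_subst TS m) \<phi>))"
  "valid L T I M (n2 8 l k) \<longleftrightarrow> length (list_decode l) = k"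
  "valid L T I M (n1 9 c) \<longleftrightarrow> (\<exists>t. c = code_tm t \<and> wf_tm L t)"
  "valid L T I M (n1 10 c) \<longleftrightarrow>
    (\<exists>ts. c = list_encode (map code_tm ts) \<and> (\<forall>t\<in>set ts. wf_tm L t))"
  "valid L T I M (n1 11 c) \<longleftrightarrow> (\<exists>\<phi>. c = code_fm \<phi> \<and> wf_fm L \<phi>)"
  "valid L T I M (n1 12 c) \<longleftrightarrow> (\<exists>\<phi>. c = code_fm \<phi> \<and> derives L T \<phi>)"
  "valid L T I M (n2 13 a c) \<longleftrightarrow> c = code_fm (graph_tr I (numeral_tm a) 0)"
  "valid L T I M (n3 14 y a c) \<longleftrightarrow> c = code_fm (is_num I a y)"
  "valid L T I M (n3 15 i xs c) \<longleftrightarrow> c = code_fm (numeral_conj I i (list_decode xs))"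
  "valid L T I M (n1 16 xs) \<longleftrightarrow> list_decode xs \<in> M"
  by (simp_all add: valid_def)

lemma list_code_eq_iff [simp]:
  "0 = list_encode (map f xs) \<longleftrightarrow> xs = []"
  "Suc (prod_encode (a, b)) = list_encode (map f xs) \<longleftrightarrow>
    (\<exists>y ys. xs = y # ys \<and> a = f y \<and> b = list_encode (map f ys))"
  by (cases xs; auto)+

text \<open>Inversion by tags: when a pattern in a clause is assumed to be a code, these equations
  recover the shape of the coded object.\<close>

lemma code_eq_iff [simp]:
  "prod_encode (k, v) = code_tm t \<longleftrightarrow> (k = 0 \<and> t = Var v) \<or>
    (k = 1 \<and> (\<exists>f ts. t = Fn f ts \<and> v = prod_encode (f, list_encode (map code_tm ts))))" (is ?thesis1)
  "prod_encode (k, v) = code_recf F \<longleftrightarrow> (k = 0 \<and> v = 0 \<and> F = Zero) \<or> (k = 1 \<and> v = 0 \<and> F = Succ) \<or>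
    (k = 2 \<and> F = Proj v) \<or>
    (k = 3 \<and> (\<exists>g hs. F = Comp g hs \<and>
      v = prod_encode (code_recf g, list_encode (map code_recf hs)))) \<or>
    (k = 4 \<and> (\<exists>f g. F = PrimRec f g \<and> v = prod_encode (code_recf f, code_recf g))) \<or>
    (k = 5 \<and> (\<exists>f. F = Mu f \<and> v = code_recf f))" (is ?thesis2)
  "prod_encode (k, v) = code_fm \<phi> \<longleftrightarrow>
    (k = 0 \<and> (\<exists>s t. \<phi> = Eq s t \<and> v = prod_encode (code_tm s, code_tm t))) \<or>
    (k = 1 \<and> (\<exists>r ts. \<phi> = Rel r ts \<and> v = prod_encode (r, list_encode (map code_tm ts)))) \<or>
    (k = 2 \<and> v = 0 \<and> \<phi> = Falsum) \<or>
    (k = 3 \<and> (\<exists>\<psi> \<chi>. \<phi> = Imp \<psi> \<chi> \<and> v = prod_encode (code_fm \<psi>, code_fm \<chi>))) \<or>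
    (k = 4 \<and> (\<exists>\<psi>. \<phi> = All \<psi> \<and> v = code_fm \<psi>))" (is ?thesis3)
proof -
  show "?thesis1" by (cases t) auto
  show "?thesis2" by (cases F) auto
  show "?thesis3" by (cases \<phi>) auto
qed

lemma code_recf_inj: "code_recf F = code_recf F' \<longleftrightarrow> F = F'"
proof -
  have "code_recf F = code_recf F' \<longrightarrow> F = F'"
  proof (induction F arbitrary: F')
    case (Comp g hs)
    then show ?case by (cases F') (auto intro: inj_list_encode_map)
  next
    case (PrimRec f g)
    then show ?case by (cases F') auto
  next
    case (Mu f)
    then show ?case by (cases F') auto
  qed (case_tac [!] F', auto)
  then show ?thesis by blast
qed

lemma code_recfs_inj:
  "list_encode (map code_recf fs) = list_encode (map code_recf gs) \<longleftrightarrow> fs = gs"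
  using inj_list_encode_map[of fs code_recf gs] by (auto simp: code_recf_inj)

lemmas code_inj = code_tm_inj code_tms_inj code_fm_inj code_recf_inj code_recfs_inj

section \<open>Soundness of the program\<close>

definition sound :: "(nat \<Rightarrow> bool) \<Rightarrow> clause list \<Rightarrow> bool" where
  "sound V P \<longleftrightarrow> (\<forall>(h, bs)\<in>set P. \<forall>\<sigma>. (\<forall>b\<in>set bs. V (pev \<sigma> b)) \<longrightarrow> V (pev \<sigma> h))"

lemma sound_hset: "sound V P \<Longrightarrow> x \<in> hset P \<Longrightarrow> V x"
  by (rotate_tac, induction rule: hset.induct) (fastforce simp: sound_def)

lemma rec_eval_Proj: "i < length xs \<Longrightarrow> xs ! i = y \<Longrightarrow> rec_eval (Proj i) xs y"
  using rec_eval.Proj by blast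

lemma sound_rec_clauses: "sound (valid L T I M) rec_clauses"
  unfolding sound_def rec_clauses_def
  by (auto simp: less_Suc_eq code_inj intro: rec_eval.intros rec_eval_Proj)

lemma sound_subst_clauses: "sound (valid L T I M) subst_clauses"
  unfolding sound_def subst_clauses_def
  by (auto simp: up_finite_subst code_inj lift_finite_subst lift_tm_def[symmetric] comp_def)

lemma sound_wf_clauses:
  assumes F: "\<And>f k y. rec_eval fF [f, k] y \<longleftrightarrow> y = (if (f, k) \<in> funs L then 1 else 0)"
    and R: "\<And>r k y. rec_eval fR [r, k] y \<longleftrightarrow> y = (if (r, k) \<in> rels L then 1 else 0)"
  shows "sound (valid L T I M) (wf_clauses fF fR)"
  unfolding sound_def wf_clauses_def
  by (auto simp: F R code_inj split: if_splits)


lemma sound_derives_clauses: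
  assumes "\<And>c. (\<exists>y. rec_eval fT [c] y) \<longleftrightarrow> (\<exists>\<phi>\<in>T. c = code_fm \<phi>)"
  shows "sound (valid L T I M) (derives_clauses fT)"
proof -
  have fT: "\<exists>\<phi>. c = code_fm \<phi> \<and> derives L T \<phi>" if "rec_eval fT [c] y" for c y
    using assms[of c] that derives.Axiom by blast
  show ?thesis
    unfolding sound_def derives_clauses_def
    by (auto simp: code_inj lift_finite_subst inst_finite_subst[symmetric] lift_fm_def[symmetric]
        intro: fT Ax_K Ax_S Ax_DN Ax_inst Ax_dist Ax_vac Ax_refl Ax_Leibniz Gen derives.MP)
qed

lemma graph_tr_numeral_0: "graph_tr I (numeral_tm 0) y = at1 (zero_fm I) y"
  by simp

lemma sound_graph_clauses: "sound (valid L T I M) (graph_clauses I)"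
  unfolding sound_def graph_clauses_def
  by (simp add: graph_tr_numeral_0 graph_tr_numeral_Suc del: numeral_tm.simps code_eq_iff)

lemma sound_is_num_clauses: "sound (valid L T I M) (is_num_clauses I y)"
  unfolding sound_def is_num_clauses_def
  by (simp add: graph_tr_numeral_0 graph_tr_numeral_Suc is_num_def
      del: numeral_tm.simps code_eq_iff)

section \<open>Completeness of the program\<close>

lemma hset_rule:
  assumes "set C \<subseteq> set P" "i < length C" "\<forall>b\<in>set (snd (C ! i)). pev (nth vs) b \<in> hset P"
  shows "pev (nth vs) (fst (C ! i)) \<in> hset P"
proof -
  have "(fst (C ! i), snd (C ! i)) \<in> set P"
    using assms(1,2) by (auto dest: nth_mem)
  then show ?thesis using assms(3) by (blast intro: hset.clause)
qed

context
  fixes P :: "clause list"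
  assumes sub: "set rec_clauses \<subseteq> set P"
begin

text \<open>Each clause is selected by its position and instantiated by the list of values of its
  pattern variables, in the order of their indices.\<close>

lemma hset_rec_rules:
  "n3 0 (Suc (prod_encode (x, xs))) 0 x \<in> hset P"
  "n3 0 xs i y \<in> hset P \<Longrightarrow> n3 0 (Suc (prod_encode (x, xs))) (Suc i) y \<in> hset P"
  "n3 (Suc 0) (n1 0 0) xs 0 \<in> hset P"
  "n3 (Suc 0) (n1 (Suc 0) 0) (Suc (prod_encode (x, 0))) (Suc x) \<in> hset P"
  "n3 0 xs i y \<in> hset P \<Longrightarrow> n3 (Suc 0) (n1 2 i) xs y \<in> hset P"
  "n3 2 hs xs ys \<in> hset P \<Longrightarrow> n3 (Suc 0) g ys z \<in> hset P \<Longrightarrow> n3 (Suc 0) (n2 3 g hs) xs z \<in> hset P"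
  "n3 (Suc 0) f xs y \<in> hset P \<Longrightarrow> n3 (Suc 0) (n2 4 f g) (Suc (prod_encode (0, xs))) y \<in> hset P"
  "n3 (Suc 0) (n2 4 f g) (Suc (prod_encode (k, xs))) y \<in> hset P \<Longrightarrow>
    n3 (Suc 0) g (Suc (prod_encode (k, Suc (prod_encode (y, xs))))) z \<in> hset P \<Longrightarrow>
    n3 (Suc 0) (n2 4 f g) (Suc (prod_encode (Suc k, xs))) z \<in> hset P"
  "n3 (Suc 0) f (Suc (prod_encode (k, xs))) 0 \<in> hset P \<Longrightarrow> n3 3 f k xs \<in> hset P \<Longrightarrow>
    n3 (Suc 0) (n1 5 f) xs k \<in> hset P"
  "n3 2 0 xs 0 \<in> hset P"
  "n3 (Suc 0) h xs y \<in> hset P \<Longrightarrow> n3 2 hs xs ys \<in> hset P \<Longrightarrow>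
    n3 2 (Suc (prod_encode (h, hs))) xs (Suc (prod_encode (y, ys))) \<in> hset P"
  "n3 3 f 0 xs \<in> hset P"
  "n3 3 f k xs \<in> hset P \<Longrightarrow> n3 (Suc 0) f (Suc (prod_encode (k, xs))) (Suc y) \<in> hset P \<Longrightarrow>
    n3 3 f (Suc k) xs \<in> hset P"
  using hset_rule[OF sub, of 0 "[x, xs]"] hset_rule[OF sub, of 1 "[x, xs, i, y]"]
    hset_rule[OF sub, of 2 "[xs]"] hset_rule[OF sub, of 3 "[x]"]
    hset_rule[OF sub, of 4 "[i, xs, y]"] hset_rule[OF sub, of 5 "[g, hs, xs, z, ys]"]
    hset_rule[OF sub, of 6 "[f, g, xs, y]"] hset_rule[OF sub, of 7 "[f, g, k, xs, z, y]"]
    hset_rule[OF sub, of 8 "[f, xs, k]"] hset_rule[OF sub, of 9 "[xs]"]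
    hset_rule[OF sub, of 10 "[h, hs, xs, y, ys]"] hset_rule[OF sub, of 11 "[f, xs]"]
    hset_rule[OF sub, of 12 "[f, k, xs, y]"]
  by (simp_all add: rec_clauses_def)

lemma hset_nth: "i < length xs \<Longrightarrow> n3 0 (list_encode xs) i (xs ! i) \<in> hset P"
proof (induction xs arbitrary: i)
  case (Cons x xs)
  then show ?case by (cases i) (auto intro: hset_rec_rules)
qed simp

lemma hset_rec_eval:
  "rec_eval f xs y \<Longrightarrow> n3 (Suc 0) (code_recf f) (list_encode xs) y \<in> hset P"
proof (induction rule: rec_eval.induct)
  case (Comp xs hs ys g z)
  from Comp(1) have "n3 2 (list_encode (map code_recf hs)) (list_encode xs) (list_encode ys) \<in> hset P"
    by (induction rule: list_all2_induct) (auto intro: hset_rec_rules)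
  with Comp show ?case by (auto intro: hset_rec_rules)
next
  case (PrimRec_Suc f g k xs y z)
  then show ?case by (auto intro: hset_rec_rules(8))
next
  case (Mu f k xs)
  have "n3 3 (code_recf f) m (list_encode xs) \<in> hset P" if "m \<le> k" for m
    using that
  proof (induction m)
    case (Suc m)
    then obtain y where "n3 (Suc 0) (code_recf f) (list_encode (m # xs)) (Suc y) \<in> hset P"
      using Mu.IH(2) Suc_le_lessD by blast
    with Suc show ?case by (auto intro: hset_rec_rules)
  qed (auto intro: hset_rec_rules)
  with Mu show ?case by (auto intro: hset_rec_rules)
qed (auto intro: hset_rec_rules hset_nth)

end

context
  fixes P :: "clause list"
  assumes sub: "set subst_clauses \<subseteq> set P"
begin

lemma hset_subst_rules:
  "n4 4 0 m 0 (n1 0 m) \<in> hset P"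
  "n4 4 0 m x (n1 0 y) \<in> hset P \<Longrightarrow> n4 4 0 m (Suc x) (n1 0 (Suc y)) \<in> hset P"
  "n4 4 (Suc (prod_encode (t, ts))) m 0 t \<in> hset P"
  "n4 4 ts m x d \<in> hset P \<Longrightarrow> n4 4 (Suc (prod_encode (t, ts))) m (Suc x) d \<in> hset P"
  "n4 4 ts m x d \<in> hset P \<Longrightarrow> n4 5 ts m (n1 0 x) d \<in> hset P"
  "n4 6 ts m c d \<in> hset P \<Longrightarrow> n4 5 ts m (n2 (Suc 0) f c) (n2 (Suc 0) f d) \<in> hset P"
  "n4 6 ts m 0 0 \<in> hset P"
  "n4 5 ts m c d \<in> hset P \<Longrightarrow> n4 6 ts m cs ds \<in> hset P \<Longrightarrow>
    n4 6 ts m (Suc (prod_encode (c, cs))) (Suc (prod_encode (d, ds))) \<in> hset P"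
  "n4 5 ts m c d \<in> hset P \<Longrightarrow> n4 5 ts m c' d' \<in> hset P \<Longrightarrow>
    n4 7 ts m (n2 0 c c') (n2 0 d d') \<in> hset P"
  "n4 6 ts m c d \<in> hset P \<Longrightarrow> n4 7 ts m (n2 (Suc 0) f c) (n2 (Suc 0) f d) \<in> hset P"
  "n4 7 ts m (n1 2 0) (n1 2 0) \<in> hset P"
  "n4 7 ts m c d \<in> hset P \<Longrightarrow> n4 7 ts m c' d' \<in> hset P \<Longrightarrow>
    n4 7 ts m (cimp c c') (cimp d d') \<in> hset P"
  "n4 6 0 (Suc 0) ts ts' \<in> hset P \<Longrightarrow> n4 7 (Suc (prod_encode (n1 0 0, ts'))) (Suc m) c d \<in> hset P
    \<Longrightarrow> n4 7 ts m (call c) (call d) \<in> hset P"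
  using hset_rule[OF sub, of 0 "[m]"] hset_rule[OF sub, of 1 "[m, x, y]"]
    hset_rule[OF sub, of 2 "[t, ts, m]"] hset_rule[OF sub, of 3 "[t, ts, m, x, d]"]
    hset_rule[OF sub, of 4 "[ts, m, x, d]"] hset_rule[OF sub, of 5 "[ts, m, f, c, d]"]
    hset_rule[OF sub, of 6 "[ts, m]"] hset_rule[OF sub, of 7 "[ts, m, c, cs, d, ds]"]
    hset_rule[OF sub, of 8 "[ts, m, c, c', d, d']"] hset_rule[OF sub, of 9 "[ts, m, f, c, d]"]
    hset_rule[OF sub, of 10 "[ts, m]"] hset_rule[OF sub, of 11 "[ts, m, c, c', d, d']"]
    hset_rule[OF sub, of 12 "[ts, m, c, d, ts']"]
  by (simp_all add: subst_clauses_def)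

lemma hset_finite_subst:
  "n4 4 (list_encode (map code_tm ts)) m x (code_tm (finite_subst ts m x)) \<in> hset P"
proof (induction ts m x rule: finite_subst.induct)
  case (1 m x)
  show ?case by (induction x) (auto intro: hset_subst_rules)
qed (auto intro: hset_subst_rules)

lemma hset_subst_tm: "n4 5 (list_encode (map code_tm ts)) m (code_tm t)
    (code_tm (subst_tm (finite_subst ts m) t)) \<in> hset P"
proof (induction t)
  case (Fn f us)
  then have "n4 6 (list_encode (map code_tm ts)) m (list_encode (map code_tm us))
      (list_encode (map code_tm (map (subst_tm (finite_subst ts m)) us))) \<in> hset P"
    by (induction us) (auto intro: hset_subst_rules)
  then show ?case by (auto intro: hset_subst_rules simp: comp_def)
qed (auto intro: hset_subst_rules hset_finite_subst)

lemma hset_subst_tms: "n4 6 (list_encode (map code_tm ts)) m (list_encode (map code_tm us))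
    (list_encode (map code_tm (map (subst_tm (finite_subst ts m)) us))) \<in> hset P"
  by (induction us) (auto intro: hset_subst_rules hset_subst_tm)

lemma hset_subst_fm: "n4 7 (list_encode (map code_tm ts)) m (code_fm \<phi>)
    (code_fm (subst_fm (finite_subst ts m) \<phi>)) \<in> hset P"
proof (induction \<phi> arbitrary: ts m)
  case (Rel r us)
  show ?case
    using hset_subst_tms[of ts m us] by (auto intro: hset_subst_rules simp: comp_def)
next
  case (All \<phi>)
  have "n4 6 0 (Suc 0) (list_encode (map code_tm ts)) (list_encode (map code_tm (map lift_tm ts)))
      \<in> hset P"
    using hset_subst_tms[of "[]" "Suc 0" ts]
    by (simp add: lift_finite_subst lift_tm_def)
  moreover have "n4 7 (Suc (prod_encode (n1 0 0, list_encode (map code_tm (map lift_tm ts)))))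
      (Suc m) (code_fm \<phi>) (code_fm (subst_fm (up (finite_subst ts m)) \<phi>)) \<in> hset P"
    using All[of "Var 0 # map lift_tm ts" "Suc m"] unfolding up_finite_subst by simp
  ultimately show ?case
    by (auto intro: hset_subst_rules)
qed (auto intro: hset_subst_rules hset_subst_tm)

end

text \<open>\<open>fF\<close> and \<open>fR\<close> decide the symbols of the language, while
  \<open>fT\<close> and \<open>fA\<close> only halt exactly on the codes of axioms and, among
  \<open>n\<close>-tuples, on the members of \<open>A\<close>.\<close>

locale provability =
  fixes L :: lang and T :: "fm set" and I :: num_transl and n :: nat and neg :: bool
    and A :: "nat list set" and fF fR fT fA :: recf
  assumes sentences: "\<forall>\<phi>\<in>T. sentence L \<phi>"
    and fF: "rec_eval fF [f, k] y \<longleftrightarrow> y = (if (f, k) \<in> funs L then 1 else 0)"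
    and fR: "rec_eval fR [f, k] y \<longleftrightarrow> y = (if (f, k) \<in> rels L then 1 else 0)"
    and fT: "(\<exists>y. rec_eval fT [c] y) \<longleftrightarrow> (\<exists>\<phi>\<in>T. c = code_fm \<phi>)"
    and fA: "length xs = n \<Longrightarrow> xs \<in> A \<longleftrightarrow> (\<exists>y. rec_eval fA xs y)"
begin

definition prog :: "clause list" where
  "prog = rec_clauses @ subst_clauses @ wf_clauses fF fR @ derives_clauses fT @ graph_clauses I @
     concat (map (is_num_clauses I) [0..<n]) @ goal_clauses neg n fA"

lemma sub_prog:
  "set rec_clauses \<subseteq> set prog" "set subst_clauses \<subseteq> set prog"
  "set (wf_clauses fF fR) \<subseteq> set prog" "set (derives_clauses fT) \<subseteq> set prog"
  "set (graph_clauses I) \<subseteq> set prog" "set (goal_clauses neg n fA) \<subseteq> set prog"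
  "y < n \<Longrightarrow> set (is_num_clauses I y) \<subseteq> set prog"
  by (auto simp: prog_def)

text \<open>The length condition makes the claim vacuous for lists of other lengths: the goal
  clauses can derive them too, and nothing is assumed about \<open>fA\<close> there.\<close>

lemma sound_prog:
  "sound (valid L T I {xs. length xs = n \<longrightarrow> xs \<in> diag_rel L T I neg n A}) prog"
    (is "sound ?V prog")
proof -
  have "sound ?V (goal_clauses neg n fA)"
    using fA unfolding sound_def goal_clauses_def
    by (auto simp: diag_rel_def tuples_def pev_pexn code_inj simp del: code_eq_iff)
  moreover have "sound ?V (concat (map (is_num_clauses I) [0..<n]))"
    using sound_is_num_clauses unfolding sound_def by fastforce
  moreover have "sound V (P @ Q) \<longleftrightarrow> sound V P \<and> sound V Q" for V P Q
    by (auto simp: sound_def)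
  ultimately show ?thesis
    unfolding prog_def
    by (simp add: sound_rec_clauses sound_subst_clauses sound_wf_clauses fF fR
        sound_derives_clauses fT sound_graph_clauses)
qed

lemmas hset_value = hset_rec_eval[OF sub_prog(1)]
lemmas wf_rule = hset_rule[OF sub_prog(3)]
lemmas derives_rule = hset_rule[OF sub_prog(4)]

lemma hset_length: "n2 8 (list_encode l) (length l) \<in> hset prog"
proof (induction l)
  case Nil
  then show ?case using wf_rule[of 0 "[]"] by (simp add: wf_clauses_def)
next
  case (Cons x xs)
  then show ?case
    using wf_rule[of 1 "[x, list_encode xs, length xs]"] by (simp add: wf_clauses_def)
qed

lemma hset_wf_tms:
  assumes "\<And>t. t \<in> set ts \<Longrightarrow> n1 9 (code_tm t) \<in> hset prog"
  shows "n1 10 (list_encode (map code_tm ts)) \<in> hset prog"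
  using assms
proof (induction ts)
  case Nil
  then show ?case using wf_rule[of 4 "[]"] by (simp add: wf_clauses_def)
next
  case (Cons t ts)
  then show ?case
    using wf_rule[of 5 "[code_tm t, list_encode (map code_tm ts)]"] by (simp add: wf_clauses_def)
qed

lemma hset_wf_tm: "wf_tm L t \<Longrightarrow> n1 9 (code_tm t) \<in> hset prog"
proof (induction t)
  case (Var x)
  then show ?case using wf_rule[of 2 "[x]"] by (simp add: wf_clauses_def)
next
  case (Fn f ts)
  then show ?case
    using wf_rule[of 3 "[f, list_encode (map code_tm ts), length ts]"]
      hset_length[of "map code_tm ts"] hset_wf_tms[of ts]
      hset_value[of fF "[f, length ts]" 1]
    by (simp add: wf_clauses_def fF)
qed

lemma hset_wf_fm: "wf_fm L \<phi> \<Longrightarrow> n1 11 (code_fm \<phi>) \<in> hset prog"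
proof (induction \<phi>)
  case (Eq s t)
  then show ?case
    using wf_rule[of 6 "[code_tm s, code_tm t]"] hset_wf_tm by (simp add: wf_clauses_def)
next
  case (Rel r ts)
  then show ?case
    using wf_rule[of 7 "[r, list_encode (map code_tm ts), length ts]"]
      hset_length[of "map code_tm ts"] hset_wf_tms[of ts] hset_wf_tm
      hset_value[of fR "[r, length ts]" 1]
    by (simp add: wf_clauses_def fR)
next
  case Falsum
  then show ?case using wf_rule[of 8 "[]"] by (simp add: wf_clauses_def)
next
  case (Imp \<phi> \<psi>)
  then show ?case
    using wf_rule[of 9 "[code_fm \<phi>, code_fm \<psi>]"] by (simp add: wf_clauses_def)
next
  case (All \<phi>)
  then show ?case using wf_rule[of 10 "[code_fm \<phi>]"] by (simp add: wf_clauses_def)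
qed

lemma hset_inst: "n4 7 (Suc (prod_encode (code_tm t, 0))) 0 (code_fm \<phi>) (code_fm (inst \<phi> t)) \<in> hset prog"
  using hset_subst_fm[OF sub_prog(2), of "[t]" 0 \<phi>] by (simp add: inst_finite_subst)

lemma hset_lift: "n4 7 0 (Suc 0) (code_fm \<phi>) (code_fm (lift_fm \<phi>)) \<in> hset prog"
  using hset_subst_fm[OF sub_prog(2), of "[]" "Suc 0" \<phi>]
  by (simp add: lift_fm_def lift_finite_subst)

lemma hset_derives: "derives L T \<phi> \<Longrightarrow> n1 12 (code_fm \<phi>) \<in> hset prog"
proof (induction rule: derives.induct)
  case (Axiom \<phi>)
  then obtain y where "rec_eval fT [code_fm \<phi>] y" using fT by blast
  then show ?case
    using derives_rule[of 0 "[code_fm \<phi>, y]"] hset_value[of fT "[code_fm \<phi>]" y]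
    by (simp add: derives_clauses_def)
next
  case (Ax_K \<phi> \<psi>)
  then show ?case
    using derives_rule[of 1 "[code_fm \<phi>, code_fm \<psi>]"] by (simp add: derives_clauses_def hset_wf_fm)
next
  case (Ax_S \<phi> \<psi> \<chi>)
  then show ?case
    using derives_rule[of 2 "[code_fm \<phi>, code_fm \<psi>, code_fm \<chi>]"]
    by (simp add: derives_clauses_def hset_wf_fm)
next
  case (Ax_DN \<phi>)
  then show ?case
    using derives_rule[of 3 "[code_fm \<phi>]"] by (simp add: derives_clauses_def hset_wf_fm)
next
  case (Ax_inst \<phi> t)
  then show ?case
    using derives_rule[of 4 "[code_fm \<phi>, code_tm t, code_fm (inst \<phi> t)]"]
    by (simp add: derives_clauses_def hset_wf_fm hset_wf_tm hset_inst)
next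
  case (Ax_dist \<phi> \<psi>)
  then show ?case
    using derives_rule[of 5 "[code_fm \<phi>, code_fm \<psi>]"] by (simp add: derives_clauses_def hset_wf_fm)
next
  case (Ax_vac \<phi>)
  then show ?case
    using derives_rule[of 6 "[code_fm \<phi>, code_fm (lift_fm \<phi>)]"]
    by (simp add: derives_clauses_def hset_wf_fm hset_lift)
next
  case (Ax_refl t)
  then show ?case
    using derives_rule[of 7 "[code_tm t]"] by (simp add: derives_clauses_def hset_wf_tm)
next
  case (Ax_Leibniz \<phi> s t)
  then show ?case
    using derives_rule[of 8 "[code_fm \<phi>, code_tm s, code_tm t, code_fm (inst \<phi> s), code_fm (inst \<phi> t)]"]
    by (simp add: derives_clauses_def hset_wf_fm hset_wf_tm hset_inst)
next
  case (MP \<phi> \<psi>)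
  then show ?case
    using derives_rule[of 9 "[code_fm \<phi>, code_fm \<psi>]"] by (simp add: derives_clauses_def)
next
  case (Gen \<phi>)
  then show ?case
    using derives_rule[of 10 "[code_fm \<phi>]"] by (simp add: derives_clauses_def)
qed

lemma hset_graph_tr: "n2 13 a (code_fm (graph_tr I (numeral_tm a) 0)) \<in> hset prog"
proof (induction a)
  case 0
  then show ?case
    using hset_rule[OF sub_prog(5), of 0 "[]"]
    by (simp add: graph_clauses_def)
next
  case (Suc a)
  then show ?case
    using hset_rule[OF sub_prog(5), of 1 "[a, code_fm (graph_tr I (numeral_tm a) 0)]"]
    by (simp add: graph_clauses_def graph_tr_numeral_Suc del: numeral_tm.simps)
qed

lemma hset_is_num: "y < n \<Longrightarrow> n3 14 y a (code_fm (is_num I a y)) \<in> hset prog"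
proof (cases a)
  case 0
  assume "y < n"
  with 0 show ?thesis
    using hset_rule[OF sub_prog(7), of y 0 "[]"]
    by (simp add: is_num_clauses_def is_num_def)
next
  case (Suc k)
  assume "y < n"
  with Suc show ?thesis
    using hset_rule[OF sub_prog(7), of y 1 "[k, code_fm (graph_tr I (numeral_tm k) 0)]"]
      hset_graph_tr[of k]
    by (simp add: is_num_clauses_def is_num_def graph_tr_numeral_Suc del: numeral_tm.simps)
qed

lemma hset_numeral_conj:
  "i + length as \<le> n \<Longrightarrow> n3 15 i (list_encode as) (code_fm (numeral_conj I i as)) \<in> hset prog"
proof (induction as arbitrary: i)
  case Nil
  then show ?case
    using hset_rule[OF sub_prog(5), of 2 "[i]"] by (simp add: graph_clauses_def)
next
  case (Cons a as)
  then show ?case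
    using hset_rule[OF sub_prog(7), of i 2
        "[a, list_encode as, code_fm (is_num I a i), code_fm (numeral_conj I (Suc i) as)]"]
      hset_is_num[of i a]
    by (simp add: is_num_clauses_def)
qed

lemma hset_diag_rel:
  assumes "xs \<in> diag_rel L T I neg n A"
  shows "n1 16 (list_encode xs) \<in> hset prog"
proof -
  obtain e a r where xs: "xs = prod_encode (e, a) # r" and l: "length xs = n"
    and "a # r \<in> A \<or> (\<exists>\<phi>. derives L T \<phi> \<and> code_fm \<phi> =
       (if neg then cneg else id) ((cex ^^ n) (cconj (code_fm (numeral_conj I 0 xs)) e)))"
    using assms unfolding diag_rel_def tuples_def by blast
  from this(3) show ?thesis
  proof
    assume "a # r \<in> A"
    then obtain y where "rec_eval fA (a # r) y" using fA[of "a # r"] l xs by auto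
    then show ?thesis
      using hset_rule[OF sub_prog(6), of 0 "[e, a, list_encode r, y]"] hset_value[of fA "a # r" y]
      by (simp add: goal_clauses_def xs)
  next
    assume "\<exists>\<phi>. derives L T \<phi> \<and> code_fm \<phi> =
       (if neg then cneg else id) ((cex ^^ n) (cconj (code_fm (numeral_conj I 0 xs)) e))"
    then have "n1 12 ((if neg then cneg else id)
        ((cex ^^ n) (cconj (code_fm (numeral_conj I 0 xs)) e))) \<in> hset prog"
      using hset_derives by metis
    then show ?thesis
      using hset_rule[OF sub_prog(6), of 1 "[e, a, list_encode r, code_fm (numeral_conj I 0 xs)]"]
        hset_numeral_conj[of 0 xs] l
      by (simp add: goal_clauses_def xs pev_pexn del: numeral_conj.simps split: if_splits)
  qed
qed

lemma RE_diag_rel: "RE_rel n (diag_rel L T I neg n A)"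
proof (rule RE_hset)
  have "recursive_fun n (\<lambda>xs. list_encode (map (\<lambda>h. h xs) (map (\<lambda>i xs. xs ! i) [0..<n])))"
    by (rule recursive_fun_list_encode) (auto simp: recursive_fun_nth)
  then have "recursive_fun n list_encode"
    by (rule recursive_fun_eqI) (auto simp: comp_def map_nth)
  then show "recursive_fun n (\<lambda>xs. n1 16 (list_encode xs))"
    by (intro recursive_fun_pair recursive_fun_const)
  show "xs \<in> diag_rel L T I neg n A \<longleftrightarrow> n1 16 (list_encode xs) \<in> hset prog" if "length xs = n" for xs
    using hset_diag_rel sound_hset[OF sound_prog, of "n1 16 (list_encode xs)"] that by auto
qed (auto simp: diag_rel_def)

end


lemma RE_diag_rel:
  assumes "RE_theory L T" and "RE_rel n A"
  shows "RE_rel n (diag_rel L T I neg n A)"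
proof -
  have T: "\<forall>\<phi>\<in>T. sentence L \<phi>" using assms(1) by (simp add: RE_theory_def)
  have "recursive_rel 2 {[f, k] | f k. (f, k) \<in> funs L}"
    and "recursive_rel 2 {[r, k] | r k. (r, k) \<in> rels L}"
    using assms(1) by (simp_all add: RE_theory_def recursive_lang_def)
  then obtain fF fR where fF: "\<forall>xs\<in>tuples 2. \<forall>y. rec_eval fF xs y \<longleftrightarrow>
      y = (if xs \<in> {[f, k] | f k. (f, k) \<in> funs L} then 1 else 0)"
    and fR: "\<forall>xs\<in>tuples 2. \<forall>y. rec_eval fR xs y \<longleftrightarrow>
      y = (if xs \<in> {[r, k] | r k. (r, k) \<in> rels L} then 1 else 0)"
    unfolding recursive_rel_def recursive_fun_def by (elim conjE exE)
  have "RE_rel 1 {[code_fm \<phi>] | \<phi>. \<phi> \<in> T}"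
    using assms(1) by (simp add: RE_theory_def)
  then obtain fT where fT: "\<forall>xs\<in>tuples 1.
      xs \<in> {[code_fm \<phi>] | \<phi>. \<phi> \<in> T} \<longleftrightarrow> (\<exists>y. rec_eval fT xs y)"
    unfolding RE_rel_def by (elim conjE exE)
  obtain fA where fA: "\<forall>xs\<in>tuples n. xs \<in> A \<longleftrightarrow> (\<exists>y. rec_eval fA xs y)"
    using assms(2) unfolding RE_rel_def by (elim conjE exE)
  interpret provability L T I n neg A fF fR fT fA
  proof
    show "rec_eval fF [f, k] y \<longleftrightarrow> y = (if (f, k) \<in> funs L then 1 else 0)" for f k y
      using fF[rule_format, of "[f, k]" y] by (simp add: tuples_def)
    show "rec_eval fR [f, k] y \<longleftrightarrow> y = (if (f, k) \<in> rels L then 1 else 0)" for f k y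
      using fR[rule_format, of "[f, k]" y] by (simp add: tuples_def)
    show "(\<exists>y. rec_eval fT [c] y) \<longleftrightarrow> (\<exists>\<phi>\<in>T. c = code_fm \<phi>)" for c
      using fT[rule_format, of "[c]"] by (auto simp: tuples_def)
    show "xs \<in> A \<longleftrightarrow> (\<exists>y. rec_eval fA xs y)" if "length xs = n" for xs
      using fA that by (simp add: tuples_def)
  qed (rule T)
  show ?thesis by (rule RE_diag_rel)
qed

section \<open>Diagonalization and exact separation\<close>

lemma recursive_functional_pair_hd:
  assumes "n \<ge> 1"
  shows "recursive_functional n (\<lambda>as. prod_encode (e, hd as) # tl as)"
  unfolding recursive_functional_def
proof (intro conjI ballI allI impI)
  show "prod_encode (e, hd as) # tl as \<in> tuples n" if "as \<in> tuples n" for as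
    using that assms by (auto simp: tuples_def)
next
  fix i assume i: "i < n"
  show "recursive_fun n (\<lambda>as. (prod_encode (e, hd as) # tl as) ! i)"
  proof (cases i)
    case 0
    have "recursive_fun n (\<lambda>as. prod_encode (e, as ! 0))"
      using assms by (intro recursive_fun_pair recursive_fun_const recursive_fun_nth) simp
    then show ?thesis
      by (rule recursive_fun_eqI) (use 0 i in \<open>auto simp: hd_conv_nth[symmetric]\<close>)
  next
    case (Suc j)
    show ?thesis
      by (rule recursive_fun_eqI[OF recursive_fun_nth[OF i]]) (use Suc i in \<open>auto simp: nth_tl\<close>)
  qed
qed

theorem theorem6p7:
  fixes L :: lang and T :: "fm set" and n :: nat and I :: num_transl
  assumes "RE_theory L T"
    and "consistent L T"
    and "n \<ge> 1"
    and "Rosser_via L T n I"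
    and "\<forall>F. recursive_functional n F \<longrightarrow> strongly_definable L T I n F"
  shows "exact_Rosser L T n"
proof -
  have T: "\<forall>\<phi>\<in>T. sentence L \<phi>" using assms(1) by (simp add: RE_theory_def)
  have I: "interpretation_Num L T I" using assms(4) by (simp add: Rosser_via_def)
  have "\<exists>\<phi>. exactly_separates L T I n \<phi> M1 M2"
    if RE: "RE_rel n M1" "RE_rel n M2" and disj: "M1 \<inter> M2 = {}" for M1 M2
  proof -
    define N1 where "N1 = diag_rel L T I True n M1"
    define N2 where "N2 = diag_rel L T I False n M2"
    have "RE_rel n N1" "RE_rel n N2"
      unfolding N1_def N2_def by (intro RE_diag_rel assms(1) RE)+
    then obtain \<psi> where \<psi>: "strongly_separates L T I n \<psi> (N1 - N2) (N2 - N1)"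
      using assms(4) unfolding Rosser_via_def by blast
    then have wf: "wf_fm L \<psi>" and fv: "fv_fm \<psi> \<subseteq> {..<n}"
      by (simp_all add: strongly_separates_def)
    \<comment> \<open>There is no circularity: \<open>N1\<close> and \<open>N2\<close> read a code
      from their argument, so \<open>\<psi>\<close> is fixed before \<open>F\<close> is built from
      its code.\<close>
    define F where "F as = prod_encode (code_fm \<psi>, hd as) # tl as" for as
    have F: "F as \<in> tuples n" if "as \<in> tuples n" for as
      using that assms(3) by (auto simp: F_def tuples_def)
    have "strongly_definable L T I n F"
      using assms(5) recursive_functional_pair_hd[OF assms(3)] unfolding F_def by blast
    then have "\<forall>i. \<exists>\<phi>. i < n \<longrightarrow> wf_fm L \<phi> \<and> fv_fm \<phi> \<subseteq> {..n} \<and> (\<forall>as\<in>tuples n.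
        derives L T (All (Iff (at_nums I \<phi> as) (is_num I (F as ! i) 0))))"
      unfolding strongly_definable_def by blast
    then obtain \<Phi> where \<Phi>: "\<And>i. i < n \<Longrightarrow> wf_fm L (\<Phi> i) \<and> fv_fm (\<Phi> i) \<subseteq> {..n} \<and>
        (\<forall>as\<in>tuples n. derives L T (All (Iff (at_nums I (\<Phi> i) as) (is_num I (F as ! i) 0))))"
      by metis
    have "exactly_separates L T I n (compose_fm I n \<Phi> \<psi>) M1 M2"
      unfolding exactly_separates_def
    proof (intro conjI ballI)
      show "wf_fm L (compose_fm I n \<Phi> \<psi>)"
        using wf \<Phi> I by (intro wf_compose_fm) (auto simp: interpretation_Num_def)
      show "fv_fm (compose_fm I n \<Phi> \<psi>) = {..<n}"
        by (rule fv_compose_fm[OF fv])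
    next
      fix as assume as: "as \<in> tuples n"
      let ?p = "derives L T (at_nums I \<psi> (F as))" and ?q = "derives L T (Neg (at_nums I \<psi> (F as)))"
      have compose: "derives L T (at_nums I (compose_fm I n \<Phi> \<psi>) as) \<longleftrightarrow> ?p"
        "derives L T (Neg (at_nums I (compose_fm I n \<Phi> \<psi>) as)) \<longleftrightarrow> ?q"
        using derives_at_nums_compose_fm[OF T I, of n \<Phi> \<psi> as "F as"] wf fv \<Phi> as F assms(3)
        by (auto simp: tuples_def)
      obtain a r where ar: "as = a # r" "length (a # r) = n"
        using as assms(3) by (cases as) (auto simp: tuples_def)
      have "F as \<in> N1 \<longleftrightarrow> as \<in> M1 \<or> ?q" "F as \<in> N2 \<longleftrightarrow> as \<in> M2 \<or> ?p"
        unfolding N1_def N2_def F_def using diag_rel_iff[OF ar(2)] by (simp_all add: ar(1))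
      moreover have "F as \<in> N1 - N2 \<Longrightarrow> ?p" "F as \<in> N2 - N1 \<Longrightarrow> ?q"
        using \<psi> F[OF as] unfolding strongly_separates_def by blast+
      moreover have "\<not> (?p \<and> ?q)"
        using assms(2) derives.MP unfolding consistent_def by blast
      \<comment> \<open>If \<open>as \<in> M1\<close>, then \<open>F as \<in> N1\<close>; by
        disjointness it is in \<open>N2\<close> only if \<open>?p\<close> holds, and otherwise
        separation gives \<open>?p\<close>. Conversely, \<open>?p\<close> puts \<open>F as\<close>
        into \<open>N2\<close> and excludes \<open>?q\<close>, so \<open>F as\<close> is in
        \<open>N1\<close> too, which leaves \<open>as \<in> M1\<close>. The case of
        \<open>M2\<close> is symmetric.\<close>
      ultimately have "(as \<in> M1 \<longleftrightarrow> ?p) \<and> (as \<in> M2 \<longleftrightarrow> ?q)"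
        using disj by blast
      then show "as \<in> M1 \<longleftrightarrow> derives L T (at_nums I (compose_fm I n \<Phi> \<psi>) as)"
        "as \<in> M2 \<longleftrightarrow> derives L T (Neg (at_nums I (compose_fm I n \<Phi> \<psi>) as))"
        by (simp_all only: compose)
    qed
    then show ?thesis ..
  qed
  with I show ?thesis unfolding exact_Rosser_def by blast
qed

end
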